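(* On a $4n$-dimensional ($n>1$) QKT manifold $(M,g,\mathcal Q)$ the scalar curvatures are related by $$Scal^g=\frac{n+2}{n}Scal_Q-3\delta t+2\|t\|^2-\frac1{12}\|T\|^2,$$ $$Scal^g_Q=Scal_Q-\delta t+\|t\|^2-\frac1{12}\|T\|^2,$$ $$Scal=\frac{n+2}{n}Scal_Q-3\delta t+2\|t\|^2-\frac13\|T\|^2.$$
   Context: An almost quaternionic structure on a $4n$-manifold $M$ is a rank-3 subbundle $\mathcal Q\subset\mathrm{End}(TM)$ locally spanned by an admissible basis $(J_1,J_2,J_3)$: $J_\alpha^2=-\mathrm{id}$, $J_1J_2=-J_2J_1=J_3$. A metric $g$ is $\mathcal Q$-hermitian if Hermitian for every almost complex structure in $\mathcal Q$. $(M,g,\mathcal Q)$ is QKT if $g$ is $\mathcal Q$-hermitian and there is a connection $\nabla$ (QKT connection) with $\nabla g=0$, preserving $\mathcal Q$, whose torsion $T(X,Y,Z)=g(T(X,Y),Z)$ is a 3-form with $T(X,Y,Z)=T(J_\alpha X,J_\alpha Y,Z)+T(J_\alpha X,Y,J_\alpha Z)+T(X,J_\alpha Y,J_\alpha Z)$ for each $\alpha$. $\{e_i\}$ is a local orthonormal frame. Torsion 1-form: $t(X)=\frac12\sum_iT(J_\alpha X,e_i,J_\alpha e_i)$ (independent of $\alpha$). $\|T\|^2=\sum_{i,j,k}T(e_i,e_j,e_k)^2$, $\|t\|^2=\sum_it(e_i)^2$, $\delta t=-\sum_i(\nabla^g_{e_i}t)(e_i)$, with $\nabla^g$ the Levi-Civita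 connection. $R(X,Y)=[\nabla_X,\nabla_Y]-\nabla_{[X,Y]}$, $R(X,Y,Z,V)=g(R(X,Y)Z,V)$; $Ric(X,Y)=\sum_iR(e_i,X,Y,e_i)$, $Scal=\sum_iRic(e_i,e_i)$, $\rho_\alpha(X,Y)=\frac12\sum_iR(X,Y,e_i,J_\alpha e_i)$. $R^g,Scal^g,\rho^g_\alpha$ are the corresponding objects for $\nabla^g$. For $n>1$, $-\sum_i\rho_\alpha(e_i,J_\alpha e_i)$ is independent of $\alpha$ and defines the global function $Scal_Q$ (quaternionic scalar curvature); likewise $-\sum_i\rho^g_\alpha(e_i,J_\alpha e_i)$ is independent of $\alpha$ and defines $Scal^g_Q$ (quaternionic $*$-scalar curvature). *)

theory Defs
  imports "HOL-Analysis.Analysis" "HOL-Library.Function_Algebras"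
begin

instantiation "fun" :: (type, real_vector) real_vector
begin

definition scaleR_fun :: "real \<Rightarrow> ('a \<Rightarrow> 'b) \<Rightarrow> 'a \<Rightarrow> 'b" where
  "scaleR_fun c f = (\<lambda>x. c *\<^sub>R f x)"

instance
  by standard (auto simp: scaleR_fun_def fun_eq_iff algebra_simps)

end


section \<open>Smooth manifolds\<close>

(* For open S, C_on k S f says that f is of class C^k on S. *)

primrec C_on :: "nat \<Rightarrow> 'a::real_normed_vector set \<Rightarrow> ('a \<Rightarrow> 'b::real_normed_vector) \<Rightarrow> bool" where
  "C_on 0 S f \<longleftrightarrow> continuous_on S f"
| "C_on (Suc k) S f \<longleftrightarrow>
     (\<forall>x\<in>S. f differentiable (at x)) \<and> (\<forall>v. C_on k S (\<lambda>x. frechet_derivative f (at x) v))"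

definition smooth_on :: "'a::real_normed_vector set \<Rightarrow> ('a \<Rightarrow> 'b::real_normed_vector) \<Rightarrow> bool" where
  "smooth_on S f \<longleftrightarrow> (\<forall>k. C_on k S f)"

(* A manifold is a whole type 'm (Hausdorff and second countable by its type classes) with a smooth
   atlas of charts (U, \<phi>), valued in a Euclidean space 'e; its dimension is DIM('e). *)

type_synonym ('m, 'e) chart = "'m set \<times> ('m \<Rightarrow> 'e)"

definition smooth_manifold ::
    "('m::{t2_space, second_countable_topology}, 'e::euclidean_space) chart set \<Rightarrow> bool" where
  "smooth_manifold A \<longleftrightarrow>
     (\<Union>(U, \<phi>)\<in>A. U) = UNIV \<and>
     (\<forall>(U, \<phi>)\<in>A. open U \<and> open (\<phi> ` U) \<and> homeomorphism U (\<phi> ` U) \<phi> (inv_into U \<phi>)) \<and>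
     (\<forall>(U, \<phi>)\<in>A. \<forall>(V, \<psi>)\<in>A. smooth_on (\<phi> ` (U \<inter> V)) (\<psi> \<circ> inv_into U \<phi>))"

(* Functions, fields and tensors are total HOL functions; what matters is their behaviour on an
   open set W, the domain of definition. *)

definition smooth_fun ::
    "('m::topological_space, 'e::euclidean_space) chart set \<Rightarrow> 'm set \<Rightarrow> ('m \<Rightarrow> real) \<Rightarrow> bool" where
  "smooth_fun A W f \<longleftrightarrow> (\<forall>(U, \<phi>)\<in>A. smooth_on (\<phi> ` (U \<inter> W)) (f \<circ> inv_into U \<phi>))"

definition smooth_near ::
    "('m::topological_space, 'e::euclidean_space) chart set \<Rightarrow> 'm \<Rightarrow> ('m \<Rightarrow> real) \<Rightarrow> bool" where
  "smooth_near A p f \<longleftrightarrow> (\<exists>W. open W \<and> p \<in> W \<and> smooth_fun A W f)"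


section \<open>Tangent vectors and vector fields\<close>

(* A tangent vector at p is identified with its action f \<mapsto> v f on the functions that are smooth
   near p.  It is set to 0 on all other functions, so that equality of functionals is equality of
   tangent vectors and the pointwise vector space operations are those of T_p M. *)

type_synonym 'm tangent = "('m \<Rightarrow> real) \<Rightarrow> real"
type_synonym 'm vfield = "'m \<Rightarrow> 'm tangent"
type_synonym 'm endofield = "'m \<Rightarrow> 'm tangent \<Rightarrow> 'm tangent"
type_synonym 'm metric = "'m \<Rightarrow> 'm tangent \<Rightarrow> 'm tangent \<Rightarrow> real"
type_synonym 'm connection = "'m vfield \<Rightarrow> 'm vfield \<Rightarrow> 'm vfield"

definition coord_vector ::
    "('m::topological_space, 'e::euclidean_space) chart set \<Rightarrow> ('m, 'e) chart \<Rightarrow> 'm \<Rightarrow> 'e \<Rightarrow> 'm tangent"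
  where
  "coord_vector A c p w = (\<lambda>f. if smooth_near A p f
     then frechet_derivative (f \<circ> inv_into (fst c) (snd c)) (at (snd c p)) w else 0)"

definition tangent_space ::
    "('m::topological_space, 'e::euclidean_space) chart set \<Rightarrow> 'm \<Rightarrow> 'm tangent set" where
  "tangent_space A p = {coord_vector A c p w | c w. c \<in> A \<and> p \<in> fst c}"

definition smooth_vfield ::
    "('m::topological_space, 'e::euclidean_space) chart set \<Rightarrow> 'm set \<Rightarrow> 'm vfield \<Rightarrow> bool" where
  "smooth_vfield A W X \<longleftrightarrow>
     (\<forall>p\<in>W. X p \<in> tangent_space A p) \<and>
     (\<forall>V f. open V \<and> V \<subseteq> W \<and> smooth_fun A V f \<longrightarrow> smooth_fun A V (\<lambda>p. X p f))"

definition lie_bracket ::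
    "('m::topological_space, 'e::euclidean_space) chart set \<Rightarrow> 'm vfield \<Rightarrow> 'm vfield \<Rightarrow> 'm vfield"
  where
  "lie_bracket A X Y = (\<lambda>p f. if smooth_near A p f
     then X p (\<lambda>q. Y q f) - Y p (\<lambda>q. X q f) else 0)"

(* Endomorphisms of T_p M are set to 0 outside T_p M. *)

definition tangent_endo ::
    "('m::topological_space, 'e::euclidean_space) chart set \<Rightarrow> 'm \<Rightarrow> ('m tangent \<Rightarrow> 'm tangent) \<Rightarrow> bool"
  where
  "tangent_endo A p L \<longleftrightarrow>
     (\<forall>x\<in>tangent_space A p. L x \<in> tangent_space A p) \<and>
     (\<forall>x\<in>tangent_space A p. \<forall>y\<in>tangent_space A p. L (x + y) = L x + L y) \<and>
     (\<forall>x\<in>tangent_space A p. \<forall>c. L (c *\<^sub>R x) = c *\<^sub>R L x) \<and>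
     (\<forall>x. x \<notin> tangent_space A p \<longrightarrow> L x = 0)"

definition smooth_endo ::
    "('m::topological_space, 'e::euclidean_space) chart set \<Rightarrow> 'm set \<Rightarrow> 'm endofield \<Rightarrow> bool" where
  "smooth_endo A W S \<longleftrightarrow>
     (\<forall>p\<in>W. tangent_endo A p (S p)) \<and>
     (\<forall>V X. open V \<and> V \<subseteq> W \<and> smooth_vfield A V X \<longrightarrow> smooth_vfield A V (\<lambda>p. S p (X p)))"

definition app :: "'m endofield \<Rightarrow> 'm vfield \<Rightarrow> 'm vfield" where
  "app S X = (\<lambda>p. S p (X p))"


section \<open>Riemannian metrics and connections\<close>

definition riemannian_metric ::
    "('m::topological_space, 'e::euclidean_space) chart set \<Rightarrow> 'm metric \<Rightarrow> bool" where
  "riemannian_metric A g \<longleftrightarrow>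
     (\<forall>p. \<forall>x\<in>tangent_space A p. \<forall>y\<in>tangent_space A p. \<forall>z\<in>tangent_space A p. \<forall>c.
        g p (x + y) z = g p x z + g p y z \<and> g p (c *\<^sub>R x) z = c * g p x z \<and> g p x y = g p y x) \<and>
     (\<forall>p. \<forall>x\<in>tangent_space A p. x \<noteq> 0 \<longrightarrow> g p x x > 0) \<and>
     (\<forall>W X Y. open W \<and> smooth_vfield A W X \<and> smooth_vfield A W Y \<longrightarrow>
        smooth_fun A W (\<lambda>p. g p (X p) (Y p)))"

(* A Koszul connection on TM, given together with its restrictions to all open sets W: the third
   clause says that it is compatible with restriction to open subsets. *)

definition is_connection ::
    "('m::topological_space, 'e::euclidean_space) chart set \<Rightarrow> 'm connection \<Rightarrow> bool" where
  "is_connection A D \<longleftrightarrow>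
     (\<forall>W X Y. open W \<and> smooth_vfield A W X \<and> smooth_vfield A W Y \<longrightarrow>
        smooth_vfield A W (D X Y) \<and>
        (\<forall>X' Y'. smooth_vfield A W X' \<and> smooth_vfield A W Y' \<longrightarrow>
           (\<forall>p\<in>W. D (X + X') Y p = D X Y p + D X' Y p \<and>
                   D X (Y + Y') p = D X Y p + D X Y' p)) \<and>
        (\<forall>X' Y'. (\<forall>p\<in>W. X' p = X p \<and> Y' p = Y p) \<longrightarrow> (\<forall>p\<in>W. D X' Y' p = D X Y p)) \<and>
        (\<forall>f. smooth_fun A W f \<longrightarrow>
           (\<forall>p\<in>W. D (\<lambda>q. f q *\<^sub>R X q) Y p = f p *\<^sub>R D X Y p \<and>
                   D X (\<lambda>q. f q *\<^sub>R Y q) p = X p f *\<^sub>R Y p + f p *\<^sub>R D X Y p)))"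

definition metric_connection ::
    "('m::topological_space, 'e::euclidean_space) chart set \<Rightarrow> 'm metric \<Rightarrow> 'm connection \<Rightarrow> bool" where
  "metric_connection A g D \<longleftrightarrow>
     (\<forall>W X Y Z. open W \<and> smooth_vfield A W X \<and> smooth_vfield A W Y \<and> smooth_vfield A W Z \<longrightarrow>
        (\<forall>p\<in>W. X p (\<lambda>q. g q (Y q) (Z q)) = g p (D X Y p) (Z p) + g p (Y p) (D X Z p)))"

definition torsion ::
    "('m::topological_space, 'e::euclidean_space) chart set \<Rightarrow> 'm connection \<Rightarrow>
     'm vfield \<Rightarrow> 'm vfield \<Rightarrow> 'm vfield" where
  "torsion A D X Y = D X Y - D Y X - lie_bracket A X Y"

definition torsion3 ::
    "('m::topological_space, 'e::euclidean_space) chart set \<Rightarrow> 'm metric \<Rightarrow> 'm connection \<Rightarrow>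
     'm vfield \<Rightarrow> 'm vfield \<Rightarrow> 'm vfield \<Rightarrow> 'm \<Rightarrow> real" where
  "torsion3 A g D X Y Z = (\<lambda>p. g p (torsion A D X Y p) (Z p))"

definition levi_civita ::
    "('m::topological_space, 'e::euclidean_space) chart set \<Rightarrow> 'm metric \<Rightarrow> 'm connection \<Rightarrow> bool" where
  "levi_civita A g D \<longleftrightarrow> is_connection A D \<and> metric_connection A g D \<and>
     (\<forall>W X Y. open W \<and> smooth_vfield A W X \<and> smooth_vfield A W Y \<longrightarrow>
        (\<forall>p\<in>W. torsion A D X Y p = 0))"


section \<open>QKT manifolds\<close>

type_synonym 'm endobundle = "'m \<Rightarrow> ('m tangent \<Rightarrow> 'm tangent) set"

definition admissible_basis ::
    "('m::topological_space, 'e::euclidean_space) chart set \<Rightarrow> 'm endobundle \<Rightarrow> 'm set \<Rightarrow>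
     (nat \<Rightarrow> 'm endofield) \<Rightarrow> bool" where
  "admissible_basis A Q W J \<longleftrightarrow>
     (\<forall>\<alpha>\<in>{1, 2, 3}. smooth_endo A W (J \<alpha>)) \<and>
     (\<forall>p\<in>W. Q p = span {J 1 p, J 2 p, J 3 p}) \<and>
     (\<forall>p\<in>W. \<forall>x\<in>tangent_space A p.
        (\<forall>\<alpha>\<in>{1, 2, 3}. J \<alpha> p (J \<alpha> p x) = - x) \<and>
        J 1 p (J 2 p x) = J 3 p x \<and> J 2 p (J 1 p x) = - J 3 p x)"

definition almost_quaternionic ::
    "('m::topological_space, 'e::euclidean_space) chart set \<Rightarrow> 'm endobundle \<Rightarrow> bool" where
  "almost_quaternionic A Q \<longleftrightarrow> (\<forall>p. \<exists>W J. open W \<and> p \<in> W \<and> admissible_basis A Q W J)"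

definition Q_hermitian ::
    "('m::topological_space, 'e::euclidean_space) chart set \<Rightarrow> 'm metric \<Rightarrow> 'm endobundle \<Rightarrow> bool" where
  "Q_hermitian A g Q \<longleftrightarrow>
     (\<forall>p. \<forall>L\<in>Q p. (\<forall>x\<in>tangent_space A p. L (L x) = - x) \<longrightarrow>
        (\<forall>x\<in>tangent_space A p. \<forall>y\<in>tangent_space A p. g p (L x) (L y) = g p x y))"

(* D maps local sections S of Q to local sections of Q, where
   (D_X S) Y = D_X (S Y) - S (D_X Y). *)

definition preserves_Q ::
    "('m::topological_space, 'e::euclidean_space) chart set \<Rightarrow> 'm endobundle \<Rightarrow> 'm connection \<Rightarrow> bool"
  where
  "preserves_Q A Q D \<longleftrightarrow>
     (\<forall>W S X. open W \<and> smooth_endo A W S \<and> (\<forall>p\<in>W. S p \<in> Q p) \<and> smooth_vfield A W X \<longrightarrow>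
        (\<forall>p\<in>W. \<exists>L\<in>Q p. \<forall>Y. smooth_vfield A W Y \<longrightarrow> D X (app S Y) p - S p (D X Y p) = L (Y p)))"

definition QKT_connection ::
    "('m::topological_space, 'e::euclidean_space) chart set \<Rightarrow> 'm metric \<Rightarrow> 'm endobundle \<Rightarrow>
     'm connection \<Rightarrow> bool" where
  "QKT_connection A g Q D \<longleftrightarrow>
     is_connection A D \<and> metric_connection A g D \<and> preserves_Q A Q D \<and>
     (\<forall>W X Y Z. open W \<and> smooth_vfield A W X \<and> smooth_vfield A W Y \<and> smooth_vfield A W Z \<longrightarrow>
        (\<forall>p\<in>W. torsion3 A g D Y X Z p = - torsion3 A g D X Y Z p \<and>
                torsion3 A g D X Z Y p = - torsion3 A g D X Y Z p) \<and>
        (\<forall>J. admissible_basis A Q W J \<longrightarrow> (\<forall>\<alpha>\<in>{1, 2, 3}. \<forall>p\<in>W.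
           torsion3 A g D X Y Z p =
             torsion3 A g D (app (J \<alpha>) X) (app (J \<alpha>) Y) Z p +
             torsion3 A g D (app (J \<alpha>) X) Y (app (J \<alpha>) Z) p +
             torsion3 A g D X (app (J \<alpha>) Y) (app (J \<alpha>) Z) p)))"

definition QKT_manifold ::
    "('m::{t2_space, second_countable_topology}, 'e::euclidean_space) chart set \<Rightarrow> 'm metric \<Rightarrow>
     'm endobundle \<Rightarrow> bool" where
  "QKT_manifold A g Q \<longleftrightarrow>
     smooth_manifold A \<and> riemannian_metric A g \<and> almost_quaternionic A Q \<and> Q_hermitian A g Q \<and>
     (\<exists>D. QKT_connection A g Q D)"


section \<open>Torsion 1-form and curvatures in a local orthonormal frame\<close>

(* A frame is a family e 1, ..., e N of vector fields, N being the dimension of the manifold. *)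

definition orthonormal_frame ::
    "('m::topological_space, 'e::euclidean_space) chart set \<Rightarrow> 'm metric \<Rightarrow> 'm set \<Rightarrow> nat \<Rightarrow>
     (nat \<Rightarrow> 'm vfield) \<Rightarrow> bool" where
  "orthonormal_frame A g W N e \<longleftrightarrow> N = DIM('e) \<and>
     (\<forall>i\<in>{1..N}. smooth_vfield A W (e i)) \<and>
     (\<forall>p\<in>W. \<forall>i\<in>{1..N}. \<forall>j\<in>{1..N}. g p (e i p) (e j p) = (if i = j then 1 else 0))"

definition torsion1 ::
    "('m::topological_space, 'e::euclidean_space) chart set \<Rightarrow> 'm metric \<Rightarrow> 'm connection \<Rightarrow> nat \<Rightarrow>
     (nat \<Rightarrow> 'm vfield) \<Rightarrow> 'm endofield \<Rightarrow> 'm vfield \<Rightarrow> 'm \<Rightarrow> real" where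
  "torsion1 A g D N e J X =
     (\<lambda>p. 1/2 * (\<Sum>i=1..N. torsion3 A g D (app J X) (e i) (app J (e i)) p))"

definition norm2_torsion ::
    "('m::topological_space, 'e::euclidean_space) chart set \<Rightarrow> 'm metric \<Rightarrow> 'm connection \<Rightarrow> nat \<Rightarrow>
     (nat \<Rightarrow> 'm vfield) \<Rightarrow> 'm \<Rightarrow> real" where
  "norm2_torsion A g D N e =
     (\<lambda>p. \<Sum>i=1..N. \<Sum>j=1..N. \<Sum>k=1..N. (torsion3 A g D (e i) (e j) (e k) p)\<^sup>2)"

definition norm2_1form ::
    "nat \<Rightarrow> (nat \<Rightarrow> 'm vfield) \<Rightarrow> ('m vfield \<Rightarrow> 'm \<Rightarrow> real) \<Rightarrow> 'm \<Rightarrow> real" where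
  "norm2_1form N e \<theta> = (\<lambda>p. \<Sum>i=1..N. (\<theta> (e i) p)\<^sup>2)"

definition codiff ::
    "'m connection \<Rightarrow> nat \<Rightarrow> (nat \<Rightarrow> 'm vfield) \<Rightarrow> ('m vfield \<Rightarrow> 'm \<Rightarrow> real) \<Rightarrow> 'm \<Rightarrow> real" where
  "codiff Dg N e \<theta> = (\<lambda>p. - (\<Sum>i=1..N. e i p (\<theta> (e i)) - \<theta> (Dg (e i) (e i)) p))"

definition curv ::
    "('m::topological_space, 'e::euclidean_space) chart set \<Rightarrow> 'm connection \<Rightarrow>
     'm vfield \<Rightarrow> 'm vfield \<Rightarrow> 'm vfield \<Rightarrow> 'm vfield" where
  "curv A D X Y Z = D X (D Y Z) - D Y (D X Z) - D (lie_bracket A X Y) Z"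

definition curv4 ::
    "('m::topological_space, 'e::euclidean_space) chart set \<Rightarrow> 'm metric \<Rightarrow> 'm connection \<Rightarrow>
     'm vfield \<Rightarrow> 'm vfield \<Rightarrow> 'm vfield \<Rightarrow> 'm vfield \<Rightarrow> 'm \<Rightarrow> real" where
  "curv4 A g D X Y Z V = (\<lambda>p. g p (curv A D X Y Z p) (V p))"

definition ricci ::
    "('m::topological_space, 'e::euclidean_space) chart set \<Rightarrow> 'm metric \<Rightarrow> 'm connection \<Rightarrow> nat \<Rightarrow>
     (nat \<Rightarrow> 'm vfield) \<Rightarrow> 'm vfield \<Rightarrow> 'm vfield \<Rightarrow> 'm \<Rightarrow> real" where
  "ricci A g D N e X Y = (\<lambda>p. \<Sum>i=1..N. curv4 A g D (e i) X Y (e i) p)"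

definition scal ::
    "('m::topological_space, 'e::euclidean_space) chart set \<Rightarrow> 'm metric \<Rightarrow> 'm connection \<Rightarrow> nat \<Rightarrow>
     (nat \<Rightarrow> 'm vfield) \<Rightarrow> 'm \<Rightarrow> real" where
  "scal A g D N e = (\<lambda>p. \<Sum>i=1..N. ricci A g D N e (e i) (e i) p)"

definition ricci_form ::
    "('m::topological_space, 'e::euclidean_space) chart set \<Rightarrow> 'm metric \<Rightarrow> 'm connection \<Rightarrow> nat \<Rightarrow>
     (nat \<Rightarrow> 'm vfield) \<Rightarrow> 'm endofield \<Rightarrow> 'm vfield \<Rightarrow> 'm vfield \<Rightarrow> 'm \<Rightarrow> real" where
  "ricci_form A g D N e J X Y =
     (\<lambda>p. 1/2 * (\<Sum>i=1..N. curv4 A g D X Y (e i) (app J (e i)) p))"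

(* With J a member of an admissible basis this is Scal_Q if D is the QKT connection, and Scal^g_Q if
   D is the Levi-Civita connection. *)

definition scalQ ::
    "('m::topological_space, 'e::euclidean_space) chart set \<Rightarrow> 'm metric \<Rightarrow> 'm connection \<Rightarrow> nat \<Rightarrow>
     (nat \<Rightarrow> 'm vfield) \<Rightarrow> 'm endofield \<Rightarrow> 'm \<Rightarrow> real" where
  "scalQ A g D N e J = (\<lambda>p. - (\<Sum>i=1..N. ricci_form A g D N e J (e i) (app J (e i)) p))"

end

theory Submission
  imports Defs
begin

text \<open>
  Write \<open>T\<close> for the torsion of the QKT connection \<open>D\<close> and \<open>t\<close> for its torsion 1-form. Since \<open>D\<close> preserves
  the quaternionic bundle, its curvature satisfies \<open>[R(X,Y), J\<^sub>1] = (\<rho>\<^sub>3(X,Y) J\<^sub>2 - \<rho>\<^sub>2(X,Y) J\<^sub>3) / n\<close>.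
  Inserting \<open>(e\<^sub>i, J\<^sub>\<alpha> e\<^sub>i, e\<^sub>j, J\<^sub>\<alpha> e\<^sub>j)\<close> into the first Bianchi identity of \<open>D\<close> and summing over the frame
  therefore expresses \<open>Scal - q\<^sub>\<alpha> - (q\<^sub>\<beta> + q\<^sub>\<gamma>) / n\<close>, where \<open>q\<^sub>\<alpha>\<close> is the trace of \<open>\<rho>\<^sub>\<alpha>\<close>, through \<open>\<delta>t\<close>, the
  norm of \<open>t\<close> and the norm of \<open>T\<close>. The right-hand side does not depend on \<open>\<alpha>\<close>, so for \<open>n > 1\<close> the three traces
  agree, and this is the formula for \<open>Scal\<close>. The Levi-Civita connection is \<open>D - T/2\<close>; taking the same traces of
  the resulting expression for its curvature gives the other two formulas.

  Vector fields are compared only on the domain \<open>W\<close> of the frame. That brackets of vector fields are again vector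
  fields is read off the torsion-free connection instead of coordinates. Tensorial expressions at a point
  are carried over to the model space \<open>'e\<close> by taking components in the frame.
\<close>

section \<open>Quaternionic curvature algebra\<close>

text \<open>That \<open>D\<close> preserves the bundle supplies the coefficients of the derivative
  of \<open>L\<close> point by point, with no smoothness, whereas commuting the curvature with
  \<open>L\<close> requires differentiating them. They are therefore recovered as traces against the
  mutually orthogonal \<open>J1\<close>, \<open>J2\<close>, \<open>J3\<close>, which exhibits them
  as smooth functions.

  That the divergence of \<open>t\<close> is a trace of the derivative of \<open>T\<close> is not
  formal either: \<open>t\<close> is built from a frame and an endomorphism, and neither is
  parallel. The frame contributes a skew matrix, the endomorphism a rotation inside the bundle
  without component along itself, and the traces of both corrections vanish. \<open>D\<close> and
  \<open>Dg\<close> yield the same divergence because \<open>T\<close> is skew.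

  The condition \<open>n > 1\<close> enters through the factor \<open>1 - 1/n\<close> in the
  differences of the three cyclic trace equations. Pairing the type condition with \<open>T\<close>
  itself produces the 1/3 in front of the norm of \<open>T\<close>; passing to the Levi-Civita
  connection adds 1/4 in the scalar curvature, and \<open>- 1/3 + 1/4 = - 1/12\<close>.\<close>

locale complex_structure =
  fixes J :: "'a::euclidean_space \<Rightarrow> 'a"
  assumes linear: "linear J"
    and square [simp]: "J (J x) = - x"
    and orthogonal [simp]: "J x \<bullet> J y = x \<bullet> y"
begin

lemmas linear_simps [simp] = linear_add[OF linear] linear_diff[OF linear] linear_neg[OF linear]
  linear_scale[OF linear] linear_0[OF linear]

lemma skew: "J x \<bullet> y = - (x \<bullet> J y)"
  using orthogonal[of x "J y"] by simp

text \<open>The matrix of an orthogonal map is orthogonal, so the trace of a bilinear form is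
  unchanged when the basis is moved by \<open>J\<close>.\<close>

lemma sum_twist:
  assumes F: "bilinear F"
  shows "(\<Sum>b\<in>Basis. F (J b) (J b)) = (\<Sum>b\<in>Basis. F b b :: real)"
proof -
  have ex: "F x y = (\<Sum>c\<in>Basis. \<Sum>d\<in>Basis. (x \<bullet> c) * (y \<bullet> d) * F c d)" for x y
  proof -
    have "F x y = F (\<Sum>c\<in>Basis. (x \<bullet> c) *\<^sub>R c) (\<Sum>d\<in>Basis. (y \<bullet> d) *\<^sub>R d)"
      by (simp add: euclidean_representation)
    also have "\<dots> = (\<Sum>(c, d)\<in>Basis \<times> Basis. F ((x \<bullet> c) *\<^sub>R c) ((y \<bullet> d) *\<^sub>R d))"
      by (rule bilinear_sum[OF F])
    also have "\<dots> = (\<Sum>(c, d)\<in>Basis \<times> Basis. (x \<bullet> c) * (y \<bullet> d) * F c d)"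
      by (intro sum.cong refl) (auto simp: bilinear_lmul[OF F] bilinear_rmul[OF F])
    finally show ?thesis
      by (simp add: sum.cartesian_product)
  qed
  \<comment> \<open>Skewness trades \<open>J b\<close> paired with \<open>c\<close> for
    \<open>b\<close> paired with \<open>J c\<close>; the two signs cancel, and the sum is the inner
    product of \<open>J c\<close> and \<open>J d\<close> expanded in the basis.\<close>
  have ip: "(\<Sum>b\<in>Basis. (J b \<bullet> c) * (J b \<bullet> d)) = c \<bullet> d" for c d
    using euclidean_inner[of "J c" "J d"]
    unfolding orthogonal inner_commute[of "J c"] inner_commute[of "J d"]
    by (simp add: skew[of _ c] skew[of _ d])
  have "(\<Sum>b\<in>Basis. F (J b) (J b))
      = (\<Sum>b\<in>Basis. \<Sum>c\<in>Basis. \<Sum>d\<in>Basis. (J b \<bullet> c) * (J b \<bullet> d) * F c d)"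
    by (intro sum.cong refl ex)
  also have "\<dots> = (\<Sum>c\<in>Basis. \<Sum>d\<in>Basis. \<Sum>b\<in>Basis. (J b \<bullet> c) * (J b \<bullet> d) * F c d)"
    by (subst sum.swap) (intro sum.cong refl sum.swap)
  also have "\<dots> = (\<Sum>c\<in>Basis. \<Sum>d\<in>Basis. (J c \<bullet> J d) * F c d)"
    unfolding sum_distrib_right[symmetric] ip by simp
  also have "\<dots> = (\<Sum>c\<in>Basis. \<Sum>d\<in>Basis. if c = d then F c d else 0)"
    by (intro sum.cong refl) (simp add: inner_Basis)
  finally show ?thesis
    by simp
qed

text \<open>This is \<open>sum_twist\<close> for the form \<open>F x (J y)\<close>; the sign comes
  from the square of \<open>J\<close>.\<close>

lemma sum_twist_left:
  assumes F: "bilinear F"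
  shows "(\<Sum>b\<in>Basis. F (J b) b) = - (\<Sum>b\<in>Basis. F b (J b) :: real)"
proof -
  have "bilinear (\<lambda>x y. F x (J y))"
    using F unfolding bilinear_def by (auto intro!: linearI simp: linear_add linear_scale)
  from sum_twist[OF this] show ?thesis
    by (simp add: bilinear_rneg[OF F] sum_negf)
qed

end

locale quaternionic_structure =
  I: complex_structure I + J: complex_structure J + K: complex_structure K
  for I J K :: "'a::euclidean_space \<Rightarrow> 'a" +
  assumes IJ [simp]: "I (J x) = K x"
    and JI [simp]: "J (I x) = - K x"
begin

lemma JK [simp]: "J (K x) = I x"
  using JI[of "J x"] K.square[of x] JI[of "I (J x)"] by (metis I.square IJ J.square JI minus_minus J.linear_simps(3))

lemma KJ [simp]: "K (J x) = - I x"
  by (metis IJ J.square I.linear_simps(3))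

lemma KI [simp]: "K (I x) = J x"
  by (metis I.square JI J.linear_simps(3) minus_equation_iff)

lemma IK [simp]: "I (K x) = - J x"
  by (metis IJ I.square)

text \<open>Cyclic symmetry allows each trace identity to be proved for \<open>I\<close> alone and
  then read off for \<open>J\<close> and \<open>K\<close>.\<close>

lemma cyclic: "quaternionic_structure J K I"
  by unfold_locales simp_all

text \<open>Moving \<open>I\<close> across the inner product of \<open>I b\<close> and
  \<open>J b\<close> leaves \<open>b\<close> paired with \<open>K b\<close>, which vanishes by
  skewness. With \<open>cyclic\<close> the three endomorphisms become orthogonal for the trace form,
  so coefficients in their span can be extracted.\<close>

lemma trace_product:
  "(\<Sum>b\<in>Basis. I b \<bullet> I b) = DIM('a)" "(\<Sum>b\<in>Basis. I b \<bullet> J b) = 0" "(\<Sum>b\<in>Basis. J b \<bullet> I b) = 0"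
proof -
  show "(\<Sum>b\<in>Basis. I b \<bullet> I b) = DIM('a)"
    by simp
  have "I b \<bullet> J b = 0" for b
    using I.skew[of b "J b"] K.skew[of b b] by (simp add: inner_commute)
  then show "(\<Sum>b\<in>Basis. I b \<bullet> J b) = 0" "(\<Sum>b\<in>Basis. J b \<bullet> I b) = 0"
    by (simp_all add: inner_commute)
qed

end

section \<open>Torsion of quaternionic type at a point\<close>

locale torsion_algebra = quaternionic_structure I J K
  for I J K :: "'a::euclidean_space \<Rightarrow> 'a" +
  fixes T :: "'a \<Rightarrow> 'a \<Rightarrow> 'a"
  assumes T_bilinear: "bilinear T"
    and T_swap: "T y x = - T x y"
    and T_inner_swap: "T x z \<bullet> y = - (T x y \<bullet> z)"
    and T_I: "T x y \<bullet> z = T (I x) (I y) \<bullet> z + T (I x) y \<bullet> I z + T x (I y) \<bullet> I z"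
    and T_J: "T x y \<bullet> z = T (J x) (J y) \<bullet> z + T (J x) y \<bullet> J z + T x (J y) \<bullet> J z"
    and T_K: "T x y \<bullet> z = T (K x) (K y) \<bullet> z + T (K x) y \<bullet> K z + T x (K y) \<bullet> K z"
begin

lemma cyclic_torsion: "torsion_algebra J K I T"
  using cyclic T_bilinear T_swap T_inner_swap T_I T_J T_K
  unfolding torsion_algebra_def torsion_algebra_axioms_def by blast

lemmas T_linear_simps [simp] = bilinear_ladd[OF T_bilinear] bilinear_radd[OF T_bilinear]
  bilinear_lzero[OF T_bilinear] bilinear_rzero[OF T_bilinear]
  bilinear_lneg[OF T_bilinear] bilinear_rneg[OF T_bilinear]
  bilinear_lmul[OF T_bilinear] bilinear_rmul[OF T_bilinear]

lemma T_cycle: "T x y \<bullet> z = T y z \<bullet> x"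
  by (metis T_inner_swap T_swap inner_minus_left minus_minus)

lemma T_diag [simp]: "T x x = 0"
  using T_swap[of x x] by (simp add: equation_minus_iff eq_neg_iff_add_eq_0 flip: scaleR_2)

text \<open>The torsion 1-form at \<open>x\<close> is half of \<open>trace1 L (L x)\<close>. The
  argument is left untwisted so that different endomorphisms can be combined.\<close>

definition trace1 :: "('a \<Rightarrow> 'a) \<Rightarrow> 'a \<Rightarrow> real" where
  "trace1 L x = (\<Sum>b\<in>Basis. T x b \<bullet> L b)"

lemma trace1_linear_simps [simp]:
  "trace1 L (x + y) = trace1 L x + trace1 L y" "trace1 L (- x) = - trace1 L x"
  "trace1 L (c *\<^sub>R x) = c * trace1 L x"
  by (simp_all add: trace1_def inner_simps sum.distrib sum_negf sum_distrib_left)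

text \<open>Apply the type condition for \<open>I\<close> inside the trace. After moving
  \<open>I\<close> by \<open>sum_twist\<close>, two of the three terms equal
  \<open>trace1 K (I x)\<close> and the third is \<open>- trace1 J x\<close>.\<close>

lemma trace1_JK: "trace1 J x = trace1 K (I x)"
proof -
  have b1: "bilinear (\<lambda>y z. T (I x) y \<bullet> K z)" "bilinear (\<lambda>y z. T x y \<bullet> J z)"
    unfolding bilinear_def by (auto intro!: linearI simp: inner_simps)
  have "(\<Sum>b\<in>Basis. T (I x) (I b) \<bullet> J b) = trace1 K (I x)"
    using I.sum_twist[OF b1(1)] by (simp add: trace1_def)
  moreover have "(\<Sum>b\<in>Basis. T x (I b) \<bullet> I (J b)) = - trace1 J x"
    using I.sum_twist[OF b1(2)] by (simp add: trace1_def sum_negf)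
  moreover have "trace1 J x = (\<Sum>b\<in>Basis. T (I x) (I b) \<bullet> J b) + (\<Sum>b\<in>Basis. T (I x) b \<bullet> I (J b))
      + (\<Sum>b\<in>Basis. T x (I b) \<bullet> I (J b))"
    unfolding trace1_def by (subst T_I) (simp only: sum.distrib)
  ultimately show ?thesis
    by (simp add: trace1_def)
qed

lemma trace1_KI: "trace1 K x = trace1 I (J x)"
proof -
  interpret c: torsion_algebra J K I T by (rule cyclic_torsion)
  show ?thesis using c.trace1_JK by (simp add: c.trace1_def trace1_def)
qed

text \<open>This is the independence of the torsion 1-form from the chosen endomorphism.\<close>

lemma trace1_I: "trace1 I (I x) = trace1 J (J x)" "trace1 K (K x) = trace1 J (J x)"
  using trace1_JK trace1_KI trace1_JK[of "J x"] trace1_KI[of "K x"] by simp_all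

text \<open>Infinitesimal form of that independence: rotating \<open>I\<close> towards
  \<open>J\<close> or \<open>K\<close> leaves \<open>trace1 I (I x)\<close> unchanged to first
  order. It removes the derivatives of the endomorphisms from the derivative of the torsion
  1-form.\<close>

lemma trace1_mixed: "trace1 I (J x) + trace1 J (I x) = 0" "trace1 I (K x) + trace1 K (I x) = 0"
  using trace1_KI[of x] trace1_JK[of "I x"] trace1_I[of "K x"] trace1_I[of "J x"] by simp_all

text \<open>\<open>G\<close> stands for the connection matrix of an orthonormal frame. A skew
  \<open>G\<close> generates rotations, under which the trace of a bilinear form is invariant; this
  is the derivative of that invariance.\<close>

lemma trace_parallel:
  assumes "linear G" "\<And>x y. G x \<bullet> y = - (x \<bullet> G y)"
  shows "(\<Sum>b\<in>Basis. T y (G b) \<bullet> I b + T y b \<bullet> I (G b)) = 0"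
proof -
  define F where "F u v = T y u \<bullet> I v" for u v
  have lin: "linear (\<lambda>u. F u v)" "linear (F v)" for v
    by (auto simp: F_def intro!: linearI simp: inner_simps)
  have r: "(\<Sum>b\<in>Basis. F (G b) b) = (\<Sum>b\<in>Basis. \<Sum>c\<in>Basis. (G b \<bullet> c) * F c b)"
  proof (intro sum.cong refl)
    fix b :: 'a
    show "F (G b) b = (\<Sum>c\<in>Basis. (G b \<bullet> c) * F c b)"
      using linear_sum[OF lin(1), of "\<lambda>c. (G b \<bullet> c) *\<^sub>R c" Basis b] linear_scale[OF lin(1)]
      by (simp add: euclidean_representation)
  qed
  have l: "(\<Sum>b\<in>Basis. F b (G b)) = (\<Sum>b\<in>Basis. \<Sum>c\<in>Basis. (G b \<bullet> c) * F b c)"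
  proof (intro sum.cong refl)
    fix b :: 'a
    show "F b (G b) = (\<Sum>c\<in>Basis. (G b \<bullet> c) * F b c)"
      using linear_sum[OF lin(2), of b "\<lambda>c. (G b \<bullet> c) *\<^sub>R c" Basis] linear_scale[OF lin(2)]
      by (simp add: euclidean_representation)
  qed
  have "(\<Sum>b\<in>Basis. F b (G b)) = (\<Sum>b\<in>Basis. \<Sum>c\<in>Basis. (G c \<bullet> b) * F c b)"
    unfolding l by (rule sum.swap)
  also have "\<dots> = - (\<Sum>b\<in>Basis. F (G b) b)"
    unfolding r sum_negf[symmetric]
    by (intro sum.cong refl) (metis assms(2) inner_commute mult_minus_left)
  finally show ?thesis
    unfolding F_def by (simp add: sum.distrib)
qed

text \<open>Expanding one factor of the squared norm by the type condition gives three pairings;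
  renaming indices and antisymmetry show that they are equal.\<close>

lemma sum_T_product:
  "(\<Sum>a\<in>Basis. \<Sum>b\<in>Basis. \<Sum>c\<in>Basis. (T a b \<bullet> c) * (T (I a) (I b) \<bullet> c))
    = (\<Sum>a\<in>Basis. \<Sum>b\<in>Basis. \<Sum>c\<in>Basis. (T a b \<bullet> c)\<^sup>2) / 3"
  (is "?P = ?N / 3")
proof -
  let ?S = "\<lambda>f. \<Sum>a\<in>Basis. \<Sum>b\<in>Basis. \<Sum>c\<in>Basis. f a b c :: real"
  have "?S (\<lambda>a b c. (T a b \<bullet> c) * (T (I a) b \<bullet> I c)) = ?S (\<lambda>a c b. (T a b \<bullet> c) * (T (I a) b \<bullet> I c))"
    by (intro sum.cong refl sum.swap)
  also have "\<dots> = ?P"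
    by (intro sum.cong refl) (subst (1 2) T_inner_swap, simp)
  finally have 1: "?S (\<lambda>a b c. (T a b \<bullet> c) * (T (I a) b \<bullet> I c)) = ?P" .
  have "?S (\<lambda>a b c. (T a b \<bullet> c) * (T a (I b) \<bullet> I c)) = ?S (\<lambda>b a c. (T a b \<bullet> c) * (T a (I b) \<bullet> I c))"
    by (rule sum.swap)
  also have "\<dots> = ?S (\<lambda>a b c. (T a b \<bullet> c) * (T (I a) b \<bullet> I c))"
    by (intro sum.cong refl) (subst (1 2) T_swap, simp)
  finally have 2: "?S (\<lambda>a b c. (T a b \<bullet> c) * (T a (I b) \<bullet> I c)) = ?P" using 1 by simp
  have "?N = ?S (\<lambda>a b c. (T a b \<bullet> c) * (T (I a) (I b) \<bullet> c) + (T a b \<bullet> c) * (T (I a) b \<bullet> I c)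
      + (T a b \<bullet> c) * (T a (I b) \<bullet> I c))"
    by (intro sum.cong refl) (subst power2_eq_square, subst (2) T_I, simp add: algebra_simps)
  also have "\<dots> = 3 * ?P"
    using 1 2 by (simp add: sum.distrib)
  finally show ?thesis by simp
qed

end

text \<open>At a point, \<open>R\<close> is the curvature of \<open>D\<close>, \<open>DT\<close> the covariant derivative of the torsion, and \<open>d\<close>
  the divergence \<open>- \<delta>t\<close>.\<close>

locale curvature_algebra = torsion_algebra I J K T
  for I J K :: "'a::euclidean_space \<Rightarrow> 'a" and T :: "'a \<Rightarrow> 'a \<Rightarrow> 'a" +
  fixes R DT :: "'a \<Rightarrow> 'a \<Rightarrow> 'a \<Rightarrow> 'a" and d :: real
  assumes R_linear: "linear (\<lambda>x. R x y z)" "linear (\<lambda>y. R x y z)" "linear (R x y)"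
    and DT_linear: "linear (\<lambda>x. DT x y z)" "linear (\<lambda>y. DT x y z)" "linear (DT x y)"
    and R_swap: "R y x z = - R x y z"
    and DT_swap: "DT x z y = - DT x y z"
    and DT_inner_swap: "DT x y v \<bullet> z = - (DT x y z \<bullet> v)"
    and R_I: "\<exists>a b c. \<forall>z. R x y (I z) - I (R x y z) = a *\<^sub>R I z + b *\<^sub>R J z + c *\<^sub>R K z"
    and R_J: "\<exists>a b c. \<forall>z. R x y (J z) - J (R x y z) = a *\<^sub>R I z + b *\<^sub>R J z + c *\<^sub>R K z"
    and R_K: "\<exists>a b c. \<forall>z. R x y (K z) - K (R x y z) = a *\<^sub>R I z + b *\<^sub>R J z + c *\<^sub>R K z"
    and bianchi: "R x y z + R y z x + R z x y
      = DT x y z + DT y z x + DT z x y + T (T x y) z + T (T y z) x + T (T z x) y"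
    and div_I: "(\<Sum>a\<in>Basis. \<Sum>b\<in>Basis. DT a (I a) b \<bullet> I b) = 2 * d"
    and div_J: "(\<Sum>a\<in>Basis. \<Sum>b\<in>Basis. DT a (J a) b \<bullet> J b) = 2 * d"
    and div_K: "(\<Sum>a\<in>Basis. \<Sum>b\<in>Basis. DT a (K a) b \<bullet> K b) = 2 * d"
begin

lemma cyclic_curvature: "curvature_algebra J K I T R DT d"
proof -
  have "\<exists>a b c. \<forall>z. R x y (L z) - L (R x y z) = a *\<^sub>R J z + b *\<^sub>R K z + c *\<^sub>R I z"
    if "\<exists>a b c. \<forall>z. R x y (L z) - L (R x y z) = a *\<^sub>R I z + b *\<^sub>R J z + c *\<^sub>R K z" for L x y
    using that by (metis add.assoc add.commute)
  then show ?thesis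
    using cyclic_torsion R_linear DT_linear R_swap DT_swap DT_inner_swap R_I R_J R_K bianchi div_I div_J div_K
    unfolding curvature_algebra_def curvature_algebra_axioms_def by meson
qed

lemmas R_linear_simps [simp] =
  linear_add[OF R_linear(1)] linear_add[OF R_linear(2)] linear_add[OF R_linear(3)]
  linear_neg[OF R_linear(1)] linear_neg[OF R_linear(2)] linear_neg[OF R_linear(3)]
  linear_scale[OF R_linear(1)] linear_scale[OF R_linear(2)] linear_scale[OF R_linear(3)]
  linear_0[OF R_linear(1)] linear_0[OF R_linear(2)] linear_0[OF R_linear(3)]

lemmas DT_linear_simps [simp] =
  linear_add[OF DT_linear(1)] linear_add[OF DT_linear(2)] linear_add[OF DT_linear(3)]
  linear_neg[OF DT_linear(1)] linear_neg[OF DT_linear(2)] linear_neg[OF DT_linear(3)]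
  linear_scale[OF DT_linear(1)] linear_scale[OF DT_linear(2)] linear_scale[OF DT_linear(3)]

definition rho :: "('a \<Rightarrow> 'a) \<Rightarrow> 'a \<Rightarrow> 'a \<Rightarrow> real" where
  "rho L x y = 1/2 * (\<Sum>b\<in>Basis. R x y b \<bullet> L b)"

definition scalar_Q :: "('a \<Rightarrow> 'a) \<Rightarrow> real" where
  "scalar_Q L = - (\<Sum>b\<in>Basis. rho L b (L b))"

definition scalar :: real where
  "scalar = (\<Sum>a\<in>Basis. \<Sum>b\<in>Basis. R b a a \<bullet> b)"

definition norm2_T :: real where
  "norm2_T = (\<Sum>a\<in>Basis. \<Sum>b\<in>Basis. \<Sum>c\<in>Basis. (T a b \<bullet> c)\<^sup>2)"

text \<open>The factor 1/4 is the square of the 1/2 in the torsion 1-form.\<close>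

definition norm2_t :: real where
  "norm2_t = 1/4 * (\<Sum>b\<in>Basis. (trace1 I (I b))\<^sup>2)"

text \<open>The coefficients are read off by taking the traces of the commutator composed with
  \<open>I\<close>, \<open>J\<close> and \<open>K\<close>.\<close>

lemma R_commutator:
  "R x y (I z) = I (R x y z) + (4 * rho K x y / DIM('a)) *\<^sub>R J z - (4 * rho J x y / DIM('a)) *\<^sub>R K z"
proof -
  obtain a b c where *: "\<And>z. R x y (I z) - I (R x y z) = a *\<^sub>R I z + b *\<^sub>R J z + c *\<^sub>R K z"
    using R_I[of x y] by blast
  have bl: "bilinear (\<lambda>u v. R x y u \<bullet> v)"
    unfolding bilinear_def by (auto intro!: linearI simp: inner_simps)
  interpret c: quaternionic_structure J K I by (rule cyclic)
  interpret c2: quaternionic_structure K I J by (rule c.cyclic)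
  let ?tr = "\<lambda>L. \<Sum>v\<in>Basis. (R x y (I v) - I (R x y v)) \<bullet> L v"
  have 1: "?tr L = a * (\<Sum>v\<in>Basis. I v \<bullet> L v) + b * (\<Sum>v\<in>Basis. J v \<bullet> L v) + c * (\<Sum>v\<in>Basis. K v \<bullet> L v)" for L
    unfolding * by (simp add: inner_simps sum.distrib sum_distrib_left)
  have 2: "?tr L = (\<Sum>v\<in>Basis. R x y (I v) \<bullet> L v + R x y v \<bullet> I (L v))" for L
    by (simp add: inner_simps I.skew)
  note tw = I.sum_twist_left
  have bl': "bilinear (\<lambda>u v. R x y u \<bullet> L v)" if "linear L" for L
    unfolding bilinear_def using that by (auto intro!: linearI simp: inner_simps linear_add linear_scale)
  have "?tr I = 0"
    unfolding 2 sum.distrib using tw[OF bl'[OF I.linear]] by simp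
  then have a: "a = 0"
    unfolding 1 trace_product c.trace_product c2.trace_product by simp
  \<comment> \<open>Both halves of the trace equal the sum of \<open>R x y v\<close> against
    \<open>K v\<close>, which is \<open>2 * rho K x y\<close>.\<close>
  have "?tr J = 4 * rho K x y"
    unfolding 2 sum.distrib using tw[OF bl'[OF J.linear]] by (simp add: rho_def sum_negf)
  then have b: "b = 4 * rho K x y / DIM('a)"
    unfolding 1 trace_product c.trace_product c2.trace_product by (simp add: field_simps)
  have "?tr K = - 4 * rho J x y"
    unfolding 2 sum.distrib using tw[OF bl'[OF K.linear]] by (simp add: rho_def sum_negf)
  then have c: "c = - 4 * rho J x y / DIM('a)"
    unfolding 1 trace_product c.trace_product c2.trace_product by (simp add: field_simps)
  show ?thesis
    using *[of z] by (simp add: a b c algebra_simps)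
qed

lemma scalar_Q_eq: "scalar_Q L = - 1/2 * (\<Sum>a\<in>Basis. \<Sum>b\<in>Basis. R a (L a) b \<bullet> L b)"
  by (simp add: scalar_Q_def rho_def sum_distrib_left sum_negf)

lemma sum_trace1_square: "(\<Sum>b\<in>Basis. (trace1 I b)\<^sup>2) = 4 * norm2_t"
proof -
  have "bilinear (\<lambda>x y. trace1 I x * trace1 I y)"
    unfolding bilinear_def by (auto intro!: linearI simp: algebra_simps)
  from I.sum_twist[OF this] show ?thesis
    by (simp add: norm2_t_def power2_eq_square)
qed

text \<open>By cyclicity of the 3-form, the sum \<open>v\<close> of the \<open>T a (I a)\<close> is
  the vector dual to \<open>trace1 I\<close>. The double trace is then \<open>trace1 I v\<close>,
  the squared norm of that covector.\<close>

lemma sum_T_T_trace: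
  "(\<Sum>a\<in>Basis. \<Sum>b\<in>Basis. T (T a (I a)) b \<bullet> I b) = 4 * norm2_t"
proof -
  define v where "v = (\<Sum>a\<in>Basis. T a (I a))"
  have vc: "v \<bullet> c = trace1 I c" for c
    unfolding v_def trace1_def inner_sum_left T_cycle[of c _ "I _"] by (rule refl)
  have v: "v = (\<Sum>c\<in>Basis. trace1 I c *\<^sub>R c)"
    using euclidean_representation[of v] unfolding vc by (rule sym)
  have l: "linear (trace1 I)"
    by (auto intro!: linearI)
  have "(\<Sum>a\<in>Basis. \<Sum>b\<in>Basis. T (T a (I a)) b \<bullet> I b) = trace1 I v"
    unfolding v_def linear_sum[OF l] by (simp only: trace1_def)
  also have "\<dots> = 4 * norm2_t"
    unfolding v linear_sum[OF l] by (simp flip: sum_trace1_square power2_eq_square)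
  finally show ?thesis .
qed

text \<open>Cyclicity turns each summand into the inner product of \<open>T a b\<close> and
  \<open>T (I a) (I b)\<close>, so \<open>sum_T_product\<close> applies.\<close>

lemma sum_T_T_twist:
  "(\<Sum>a\<in>Basis. \<Sum>b\<in>Basis. T (T a b) (I a) \<bullet> I b) = norm2_T / 3"
  unfolding norm2_T_def sum_T_product[symmetric]
proof (intro sum.cong refl)
  fix a b :: 'a
  have "T (T a b) (I a) \<bullet> I b = T a b \<bullet> T (I a) (I b)"
    using T_cycle[of "T a b" "I a" "I b"] by (simp add: inner_commute)
  then show "T (T a b) (I a) \<bullet> I b = (\<Sum>c\<in>Basis. (T a b \<bullet> c) * (T (I a) (I b) \<bullet> c))"
    by (simp only: euclidean_inner[of "T a b" "T (I a) (I b)"])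
qed

text \<open>Commuting \<open>I\<close> past the curvature leaves the scalar curvature, since
  \<open>I\<close> is orthogonal. In the correction, \<open>rho K\<close> multiplies
  \<open>J a\<close> paired with \<open>I b\<close>, which is \<open>- K a\<close> paired with
  \<open>b\<close>; contraction thus produces the trace of \<open>rho K\<close>, and likewise that
  of \<open>rho J\<close>.\<close>

lemma sum_R_twist:
  "(\<Sum>a\<in>Basis. \<Sum>b\<in>Basis. R b a (I a) \<bullet> I b) = scalar - 4 / DIM('a) * (scalar_Q J + scalar_Q K)"
proof -
  have rl: "linear (\<lambda>u. rho L u v)" "linear (rho L v)" for L v
    by (auto intro!: linearI simp: rho_def inner_simps sum.distrib add_divide_distrib simp flip: sum_distrib_left)
  have ex: "(\<Sum>b\<in>Basis. rho L b a * (v \<bullet> b)) = rho L v a" for L a v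
    using linear_sum[OF rl(1)[of L a], of "\<lambda>b. (v \<bullet> b) *\<^sub>R b" Basis] linear_scale[OF rl(1)]
    by (simp add: euclidean_representation mult.commute)
  have bl: "bilinear (rho L)" for L
    unfolding bilinear_def using rl by blast
  have tr: "(\<Sum>a\<in>Basis. rho J (J a) a) = scalar_Q J" "(\<Sum>a\<in>Basis. rho K (K a) a) = scalar_Q K"
    using J.sum_twist_left[OF bl] K.sum_twist_left[OF bl] by (simp_all add: scalar_Q_def)
  let ?k = "4 / real DIM('a)"
  have "R b a (I a) \<bullet> I b = R b a a \<bullet> b - ?k * (rho K b a * (K a \<bullet> b)) - ?k * (rho J b a * (J a \<bullet> b))" for a b
  proof -
    have 1: "J a \<bullet> I b = - (K a \<bullet> b)" "K a \<bullet> I b = J a \<bullet> b"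
      using I.skew[of "J a" b] I.skew[of "K a" b] by simp_all
    show ?thesis
      unfolding R_commutator[of b a a] by (simp add: inner_simps 1)
  qed
  then have "(\<Sum>a\<in>Basis. \<Sum>b\<in>Basis. R b a (I a) \<bullet> I b)
      = scalar - ?k * (\<Sum>a\<in>Basis. rho K (K a) a) - ?k * (\<Sum>a\<in>Basis. rho J (J a) a)"
    by (simp only: sum_subtractf sum_distrib_left[symmetric] ex scalar_def)
  then show ?thesis
    unfolding tr distrib_left by simp
qed

lemma bianchi_trace:
  "scalar - scalar_Q I - 4 / DIM('a) * (scalar_Q J + scalar_Q K) = 3 * d + 2 * norm2_t - norm2_T / 3"
proof -
  let ?S = "\<lambda>f. \<Sum>a\<in>Basis. \<Sum>b\<in>Basis. f a b :: real"
  have bl: "bilinear (\<lambda>x y. \<Sum>b\<in>Basis. R x b y \<bullet> I b)" "bilinear (\<lambda>x y. \<Sum>b\<in>Basis. DT x b y \<bullet> I b)"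
    "bilinear (\<lambda>x y. \<Sum>b\<in>Basis. T (T x b) y \<bullet> I b)"
    unfolding bilinear_def by (auto intro!: linearI simp: inner_simps sum.distrib sum_distrib_left)
  \<comment> \<open>The second and third curvature terms of the Bianchi sum have the same trace, the
    one evaluated by \<open>sum_R_twist\<close>.\<close>
  have R: "?S (\<lambda>a b. R (I a) b a \<bullet> I b) = ?S (\<lambda>a b. R b a (I a) \<bullet> I b)"
    using I.sum_twist_left[OF bl(1)]
    by (simp only: sum_negf[symmetric] inner_minus_left[symmetric] R_swap[symmetric])
  have D1: "?S (\<lambda>a b. DT (I a) b a \<bullet> I b) = 2 * d"
    using I.sum_twist_left[OF bl(2)]
    by (simp only: sum_negf[symmetric] inner_minus_left[symmetric] DT_swap[symmetric] div_I)
  \<comment> \<open>In its last three arguments \<open>DT\<close> is totally antisymmetric, and up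
    to the names of the indices they are a cyclic permutation of those in
    \<open>div_I\<close>.\<close>
  have "?S (\<lambda>a b. DT b a (I a) \<bullet> I b) = ?S (\<lambda>a b. DT b (I b) a \<bullet> I a)"
    by (intro sum.cong refl) (metis DT_inner_swap DT_swap inner_minus_left minus_minus)
  also have "\<dots> = 2 * d"
    by (subst sum.swap) (rule div_I)
  finally have D2: "?S (\<lambda>a b. DT b a (I a) \<bullet> I b) = 2 * d" .
  have T1: "?S (\<lambda>a b. T (T (I a) b) a \<bullet> I b) = - norm2_T / 3"
    using I.sum_twist_left[OF bl(3)] sum_T_T_twist by simp
  have T2: "?S (\<lambda>a b. T (T b a) (I a) \<bullet> I b) = - norm2_T / 3"
    using sum_T_T_twist by (subst T_swap) (simp add: sum_negf)
  have "?S (\<lambda>a b. (R a (I a) b + R (I a) b a + R b a (I a)) \<bullet> I b)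
     = ?S (\<lambda>a b. (DT a (I a) b + DT (I a) b a + DT b a (I a) + T (T a (I a)) b + T (T (I a) b) a
        + T (T b a) (I a)) \<bullet> I b)"
    by (simp only: bianchi)
  then have "?S (\<lambda>a b. R a (I a) b \<bullet> I b) + ?S (\<lambda>a b. R b a (I a) \<bullet> I b) + ?S (\<lambda>a b. R b a (I a) \<bullet> I b)
      = 2 * d + 2 * d + 2 * d + 4 * norm2_t + - norm2_T / 3 + - norm2_T / 3"
    unfolding inner_add_left sum.distrib R D1 D2 T1 T2 div_I sum_T_T_trace add.assoc .
  then have "?S (\<lambda>a b. R a (I a) b \<bullet> I b) + 2 * ?S (\<lambda>a b. R b a (I a) \<bullet> I b)
      = 6 * d + 4 * norm2_t - 2 * (norm2_T / 3)"
    by linarith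
  note * = this
  have "r / 2 + s = 3 * d + 2 * norm2_t - norm2_T / 3" if "r + 2 * s = 6 * d + 4 * norm2_t - 2 * (norm2_T / 3)"
    for r s
    using that by linarith
  from this[OF *] show ?thesis
    unfolding scalar_Q_eq[of I] sum_R_twist by linarith
qed

end

text \<open>For \<open>n = 1\<close> the three equations coincide. For larger \<open>n\<close> their
  differences are \<open>(1 - 1/n) * (q2 - q1) = 0\<close> and its analogue, with a nonzero
  factor.\<close>

lemma cyclic_equations_solution:
  fixes s q1 q2 q3 B :: real and n :: nat
  assumes n: "n > 1"
    and e: "s - q1 - 1 / n * (q2 + q3) = B" "s - q2 - 1 / n * (q3 + q1) = B" "s - q3 - 1 / n * (q1 + q2) = B"
  shows "q2 = q1" "q3 = q1" "s = (real n + 2) / n * q1 + B"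
proof -
  define r where "r = 1 / real n"
  have r: "1 - r \<noteq> 0"
    using n by (simp add: r_def)
  have "(1 - r) * (q2 - q1) = 0" "(1 - r) * (q3 - q1) = 0"
    using e unfolding r_def[symmetric] ring_distribs by linarith+
  then show q: "q2 = q1" "q3 = q1"
    using r by simp_all
  show "s = (real n + 2) / n * q1 + B"
    using e(1) n unfolding q by (simp add: field_simps)
qed

lemma (in curvature_algebra) scalar_curvatures:
  assumes n: "DIM('a) = 4 * n" "n > 1"
  shows "scalar_Q J = scalar_Q I" "scalar_Q K = scalar_Q I"
    "scalar = (real n + 2) / real n * scalar_Q I + (3 * d + 2 * norm2_t - norm2_T / 3)"
proof -
  interpret c: curvature_algebra J K I T R DT d by (rule cyclic_curvature)
  interpret c2: curvature_algebra K I J T R DT d by (rule c.cyclic_curvature)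
  \<comment> \<open>The three cyclic copies of \<open>bianchi_trace\<close> share one right-hand
    side because the norm of the torsion 1-form does not depend on the endomorphism.\<close>
  have t: "c.norm2_t = norm2_t" "c2.norm2_t = norm2_t"
    unfolding norm2_t_def c.norm2_t_def c2.norm2_t_def trace1_I by (rule refl)+
  have k: "4 / real DIM('a) = 1 / real n"
    using n by simp
  note e = cyclic_equations_solution[OF n(2) bianchi_trace[unfolded k] c.bianchi_trace[unfolded k t]
      c2.bianchi_trace[unfolded k t]]
  show "scalar_Q J = scalar_Q I" "scalar_Q K = scalar_Q I"
    "scalar = (real n + 2) / real n * scalar_Q I + (3 * d + 2 * norm2_t - norm2_T / 3)"
    by (rule e)+
qed

section \<open>Traces of the Levi-Civita curvature\<close>

context curvature_algebra begin

text \<open>The curvature of \<open>D - T/2\<close>.\<close>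

definition LC :: "'a \<Rightarrow> 'a \<Rightarrow> 'a \<Rightarrow> 'a" where
  "LC x y z = R x y z - (1/2) *\<^sub>R (DT x y z - DT y x z) - (1/2) *\<^sub>R T (T x y) z
    + (1/4) *\<^sub>R (T x (T y z) - T y (T x z))"

text \<open>Skewness kills the \<open>DT\<close> terms. The squared norm of each
  \<open>T a b\<close> appears with 1/2 from \<open>T (T b a) a\<close> and with - 1/4 from
  \<open>T a (T b a)\<close>, hence with 1/4 in total.\<close>

lemma scalar_LC: "(\<Sum>a\<in>Basis. \<Sum>b\<in>Basis. LC b a a \<bullet> b) = scalar + norm2_T / 4"
proof -
  have DT0: "DT x y y = 0" "DT x y z \<bullet> y = 0" for x y z
  proof -
    show 1: "DT x y y = 0" for x y
      using DT_swap[of x y y] by (simp add: equation_minus_iff eq_neg_iff_add_eq_0 flip: scaleR_2)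
    have "DT x y z \<bullet> y = - (DT x y y \<bullet> z)"
      by (rule DT_inner_swap)
    then show "DT x y z \<bullet> y = 0"
      by (simp add: 1)
  qed
  have "T (T b a) a \<bullet> b = - (T a b \<bullet> T a b)" "T a (T b a) \<bullet> b = T a b \<bullet> T a b" for a b
    using T_cycle[of a b "T b a"] T_cycle[of "T b a" a b] T_swap[of a b] T_inner_swap[of a "T b a" b]
    by simp_all
  then have "(\<Sum>a\<in>Basis. \<Sum>b\<in>Basis. LC b a a \<bullet> b) = (\<Sum>a\<in>Basis. \<Sum>b\<in>Basis. R b a a \<bullet> b + 1/4 * (T a b \<bullet> T a b))"
    by (intro sum.cong refl) (simp add: LC_def inner_simps DT0)
  also have "\<dots> = scalar + norm2_T / 4"
    unfolding scalar_def norm2_T_def power2_eq_square euclidean_inner[symmetric]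
    by (simp add: sum.distrib sum_divide_distrib)
  finally show ?thesis .
qed

text \<open>The two \<open>DT\<close> traces are opposite and together give \<open>d\<close>; the
  trace of \<open>T (T a (I a))\<close> gives \<open>norm2_t\<close>. The last bracket of
  \<open>LC\<close> gives 1/4 times 2/3 of the norm of \<open>T\<close>, and the prefactor
  \<open>- 1/2\<close> turns this into - 1/12.\<close>

lemma scalar_Q_LC:
  "- 1/2 * (\<Sum>a\<in>Basis. \<Sum>b\<in>Basis. LC a (I a) b \<bullet> I b) = scalar_Q I + d + norm2_t - norm2_T / 12"
proof -
  let ?S = "\<lambda>f. \<Sum>a\<in>Basis. \<Sum>b\<in>Basis. f a b :: real"
  have bl: "bilinear (\<lambda>x y. \<Sum>b\<in>Basis. DT x y b \<bullet> I b)"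
    "bilinear (\<lambda>x y. \<Sum>b\<in>Basis. T y (T x b) \<bullet> I b)"
    unfolding bilinear_def by (auto intro!: linearI simp: inner_simps sum.distrib sum_distrib_left)
  have D: "?S (\<lambda>a b. DT (I a) a b \<bullet> I b) = - (2 * d)"
    using I.sum_twist_left[OF bl(1)] div_I by simp
  have T2: "?S (\<lambda>a b. T (I a) (T a b) \<bullet> I b) = - (norm2_T / 3)"
    using sum_T_T_twist by (subst T_swap) (simp add: sum_negf)
  have T1: "?S (\<lambda>a b. T a (T (I a) b) \<bullet> I b) = norm2_T / 3"
    using I.sum_twist_left[OF bl(2)] T2 by simp
  have "?S (\<lambda>a b. LC a (I a) b \<bullet> I b)
     = ?S (\<lambda>a b. R a (I a) b \<bullet> I b) - 1/2 * (?S (\<lambda>a b. DT a (I a) b \<bullet> I b) - ?S (\<lambda>a b. DT (I a) a b \<bullet> I b))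
      - 1/2 * ?S (\<lambda>a b. T (T a (I a)) b \<bullet> I b)
      + 1/4 * (?S (\<lambda>a b. T a (T (I a) b) \<bullet> I b) - ?S (\<lambda>a b. T (I a) (T a b) \<bullet> I b))"
    unfolding LC_def inner_add_left inner_diff_left inner_scaleR_left sum.distrib sum_subtractf
      sum_distrib_left[symmetric] ..
  then show ?thesis
    unfolding D T1 T2 sum_T_T_trace div_I scalar_Q_eq by argo
qed

lemma scalar_Q_LC_cyclic:
  "- 1/2 * (\<Sum>a\<in>Basis. \<Sum>b\<in>Basis. LC a (J a) b \<bullet> J b) = scalar_Q J + d + norm2_t - norm2_T / 12"
  "- 1/2 * (\<Sum>a\<in>Basis. \<Sum>b\<in>Basis. LC a (K a) b \<bullet> K b) = scalar_Q K + d + norm2_t - norm2_T / 12"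
proof -
  interpret c: curvature_algebra J K I T R DT d by (rule cyclic_curvature)
  interpret c2: curvature_algebra K I J T R DT d by (rule c.cyclic_curvature)
  show "- 1/2 * (\<Sum>a\<in>Basis. \<Sum>b\<in>Basis. LC a (J a) b \<bullet> J b) = scalar_Q J + d + norm2_t - norm2_T / 12"
    "- 1/2 * (\<Sum>a\<in>Basis. \<Sum>b\<in>Basis. LC a (K a) b \<bullet> K b) = scalar_Q K + d + norm2_t - norm2_T / 12"
    using c.scalar_Q_LC c2.scalar_Q_LC unfolding norm2_t_def c.norm2_t_def c2.norm2_t_def trace1_I .
qed

end

section \<open>Smooth manifolds, tangent spaces and connections\<close>

lemma C_on_subset: "C_on k S f \<Longrightarrow> T \<subseteq> S \<Longrightarrow> C_on k T f"
  by (induction k arbitrary: f) (auto intro: continuous_on_subset)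

text \<open>Openness of \<open>S\<close> makes the unrestricted derivative at a point of
  \<open>S\<close> depend only on the values on \<open>S\<close>.\<close>

lemma C_on_cong:
  assumes "open S" "\<And>x. x \<in> S \<Longrightarrow> f x = g x" "C_on k S f"
  shows "C_on k S g"
  using assms(2,3)
proof (induction k arbitrary: f g)
  case 0
  then show ?case
    using continuous_on_cong[of S S f g] by simp
next
  case (Suc k)
  have d: "(g has_derivative frechet_derivative f (at x)) (at x)" if "x \<in> S" for x
    using has_derivative_transform_within_open[OF _ assms(1) that Suc.prems(1)] Suc.prems(2) that
    by (auto simp: frechet_derivative_works)
  then have "frechet_derivative g (at x) = frechet_derivative f (at x)" if "x \<in> S" for x
    using frechet_derivative_at[OF d[OF that]] by simp
  then have "C_on k S (\<lambda>x. frechet_derivative g (at x) v)" for v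
    using Suc.IH[of "\<lambda>x. frechet_derivative f (at x) v" "\<lambda>x. frechet_derivative g (at x) v"] Suc.prems(2)
    by simp
  then show ?case
    using d by (auto simp: differentiable_def)
qed

text \<open>The product rule needs this: there an undifferentiated factor of class
  \<open>Suc k\<close> multiplies a derivative of class \<open>k\<close>.\<close>

lemma C_on_pred: "C_on (Suc k) S f \<Longrightarrow> C_on k S f"
proof (induction k arbitrary: f)
  case 0
  then show ?case
    by (auto intro!: continuous_at_imp_continuous_on differentiable_imp_continuous_within)
next
  case (Suc k)
  then have "C_on k S (\<lambda>x. frechet_derivative f (at x) v)" for v
    by (metis C_on.simps(2))
  then show ?case
    using Suc.prems by simp
qed

lemma C_on_const: "C_on k S (\<lambda>x. c)"
  by (induction k arbitrary: c) simp_all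

lemma C_on_add:
  assumes "open S" "C_on k S f" "C_on k S g"
  shows "C_on k S (\<lambda>x. f x + g x)"
  using assms(2,3)
proof (induction k arbitrary: f g)
  case 0
  then show ?case by (simp add: continuous_on_add)
next
  case (Suc k)
  have "frechet_derivative (\<lambda>x. f x + g x) (at x) v = frechet_derivative f (at x) v + frechet_derivative g (at x) v"
    if "x \<in> S" for x v
    using Suc.prems that
      frechet_derivative_at[OF has_derivative_add[of f "frechet_derivative f (at x)" "at x" g "frechet_derivative g (at x)"]]
    by (simp add: frechet_derivative_works) metis
  then have "C_on k S (\<lambda>x. frechet_derivative (\<lambda>x. f x + g x) (at x) v)" for v
    using C_on_cong[OF assms(1) _ Suc.IH[of "\<lambda>x. frechet_derivative f (at x) v" "\<lambda>x. frechet_derivative g (at x) v"]]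
      Suc.prems by simp
  then show ?case using Suc.prems by simp
qed

lemma C_on_mult:
  fixes f g :: "'a::real_normed_vector \<Rightarrow> real"
  assumes "open S" "C_on k S f" "C_on k S g"
  shows "C_on k S (\<lambda>x. f x * g x)"
  using assms(2,3)
proof (induction k arbitrary: f g)
  case 0
  then show ?case by (simp add: continuous_on_mult)
next
  case (Suc k)
  have d: "((\<lambda>x. f x * g x) has_derivative
      (\<lambda>v. f x * frechet_derivative g (at x) v + frechet_derivative f (at x) v * g x)) (at x)"
    if "x \<in> S" for x
    using Suc.prems that by (intro has_derivative_mult) (auto simp: frechet_derivative_works)
  have "frechet_derivative (\<lambda>x. f x * g x) (at x) v
      = f x * frechet_derivative g (at x) v + frechet_derivative f (at x) v * g x"
    if "x \<in> S" for x v
    using frechet_derivative_at[OF d[OF that]] by metis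
  moreover have "C_on k S (\<lambda>x. f x * frechet_derivative g (at x) v + frechet_derivative f (at x) v * g x)" for v
    using Suc.prems C_on_pred[of k S f] C_on_pred[of k S g] by (intro C_on_add assms(1) Suc.IH) auto
  ultimately have "C_on k S (\<lambda>x. frechet_derivative (\<lambda>x. f x * g x) (at x) v)" for v
    using C_on_cong[OF assms(1), of "\<lambda>x. f x * frechet_derivative g (at x) v + frechet_derivative f (at x) v * g x"]
    by simp
  then show ?case using d by (auto simp: differentiable_def)
qed

lemma smooth_on_differentiable: "smooth_on S f \<Longrightarrow> x \<in> S \<Longrightarrow> f differentiable (at x)"
  unfolding smooth_on_def by (metis C_on.simps(2))

section \<open>Smooth functions, tangent vectors and vector fields\<close>

locale manifold =
  fixes A :: "('m::{t2_space, second_countable_topology}, 'e::euclidean_space) chart set"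
  assumes manifold: "smooth_manifold A"
begin

lemma chart_exists: obtains c where "c \<in> A" "p \<in> fst c"
proof -
  have "p \<in> (\<Union>(U, \<phi>)\<in>A. U)"
    using manifold by (simp add: smooth_manifold_def)
  then show ?thesis
    using that by fastforce
qed

lemma chart:
  assumes "c \<in> A"
  shows chart_open: "open (fst c)"
    and chart_inv: "\<And>p. p \<in> fst c \<Longrightarrow> inv_into (fst c) (snd c) (snd c p) = p"
    and chart_open_image: "open W \<Longrightarrow> open (snd c ` (fst c \<inter> W))"
proof -
  have h: "open (fst c)" "open (snd c ` fst c)"
    "homeomorphism (fst c) (snd c ` fst c) (snd c) (inv_into (fst c) (snd c))"
    using manifold assms unfolding smooth_manifold_def by force+
  show "open (fst c)" by (rule h)
  show "inv_into (fst c) (snd c) (snd c p) = p" if "p \<in> fst c" for p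
    using homeomorphism_apply1[OF h(3) that] .
  show "open (snd c ` (fst c \<inter> W))" if "open W"
  proof -
    have "openin (top_of_set (fst c)) (fst c \<inter> W)"
      using that by auto
    from homeomorphism_imp_open_map[OF h(3) this] h(2) show ?thesis
      by (simp add: openin_open_eq)
  qed
qed

lemma smooth_funI:
  assumes "\<And>c. c \<in> A \<Longrightarrow> smooth_on (snd c ` (fst c \<inter> W)) (f \<circ> inv_into (fst c) (snd c))"
  shows "smooth_fun A W f"
  using assms unfolding smooth_fun_def by force

lemma smooth_funD:
  assumes "smooth_fun A W f" "c \<in> A"
  shows "smooth_on (snd c ` (fst c \<inter> W)) (f \<circ> inv_into (fst c) (snd c))"
  using assms unfolding smooth_fun_def by force

lemma smooth_fun_subset: "smooth_fun A W f \<Longrightarrow> V \<subseteq> W \<Longrightarrow> smooth_fun A V f"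
  unfolding smooth_fun_def smooth_on_def
  by (fast intro: C_on_subset)

lemma smooth_fun_cong:
  assumes "open W" "smooth_fun A W f" "\<And>p. p \<in> W \<Longrightarrow> f p = h p"
  shows "smooth_fun A W h"
proof (rule smooth_funI)
  fix c assume c: "c \<in> A"
  have "(f \<circ> inv_into (fst c) (snd c)) y = (h \<circ> inv_into (fst c) (snd c)) y" if "y \<in> snd c ` (fst c \<inter> W)" for y
    using that assms(3) chart_inv[OF c] by auto
  then show "smooth_on (snd c ` (fst c \<inter> W)) (h \<circ> inv_into (fst c) (snd c))"
    using smooth_funD[OF assms(2) c] C_on_cong[OF chart_open_image[OF c assms(1)]]
    unfolding smooth_on_def by blast
qed

lemma smooth_fun_const [simp]: "smooth_fun A W (\<lambda>p. c)"
  unfolding smooth_fun_def smooth_on_def comp_def by (auto simp: C_on_const)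

lemma smooth_fun_add:
  "open W \<Longrightarrow> smooth_fun A W f \<Longrightarrow> smooth_fun A W h \<Longrightarrow> smooth_fun A W (\<lambda>p. f p + h p)"
  unfolding smooth_fun_def smooth_on_def comp_def
  using C_on_add[OF chart_open_image] by fastforce

lemma smooth_fun_mult:
  "open W \<Longrightarrow> smooth_fun A W f \<Longrightarrow> smooth_fun A W h \<Longrightarrow> smooth_fun A W (\<lambda>p. f p * h p)"
  unfolding smooth_fun_def smooth_on_def comp_def
  using C_on_mult[OF chart_open_image] by fastforce

lemma smooth_fun_sum:
  "open W \<Longrightarrow> (\<And>i. i \<in> I \<Longrightarrow> smooth_fun A W (f i)) \<Longrightarrow> smooth_fun A W (\<lambda>p. \<Sum>i\<in>I. f i p)"
  by (induction I rule: infinite_finite_induct) (auto intro: smooth_fun_add)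

lemma smooth_near_differentiable:
  assumes "smooth_near A p f" "c \<in> A" "p \<in> fst c"
  shows "(f \<circ> inv_into (fst c) (snd c)) differentiable (at (snd c p))"
proof -
  obtain W where "p \<in> W" "smooth_fun A W f"
    using assms(1) by (auto simp: smooth_near_def)
  then show ?thesis
    using smooth_on_differentiable[OF smooth_funD] assms(2,3) by blast
qed

lemma coord_vector_linear:
  assumes "c \<in> A" "p \<in> fst c"
  shows "linear (coord_vector A c p)"
proof (rule linearI)
  fix v w :: 'e and r :: real
  have "linear (frechet_derivative (f \<circ> inv_into (fst c) (snd c)) (at (snd c p)))" if "smooth_near A p f" for f
    using smooth_near_differentiable[OF that assms] by (rule linear_frechet_derivative)
  then show "coord_vector A c p (v + w) = coord_vector A c p v + coord_vector A c p w"
    "coord_vector A c p (r *\<^sub>R w) = r *\<^sub>R coord_vector A c p w"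
    by (auto simp: coord_vector_def fun_eq_iff scaleR_fun_def linear_add linear_scale)
qed

text \<open>The chain rule through the transition map. The tangent space is defined by ranging over
  all charts at the point; this rule makes it the image of any single one, and hence a vector
  space.\<close>

lemma coord_vector_change:
  assumes c: "c \<in> A" "p \<in> fst c" and d: "d \<in> A" "p \<in> fst d"
  shows "coord_vector A d p w = coord_vector A c p
    (frechet_derivative (snd c \<circ> inv_into (fst d) (snd d)) (at (snd d p)) w)"
proof
  fix f
  let ?\<tau> = "snd c \<circ> inv_into (fst d) (snd d)"
  show "coord_vector A d p w f = coord_vector A c p (frechet_derivative ?\<tau> (at (snd d p)) w) f"
  proof (cases "smooth_near A p f")
    case True
    have "smooth_on (snd d ` (fst d \<inter> fst c)) ?\<tau>"
      using manifold c d unfolding smooth_manifold_def by fastforce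
    then have t: "(?\<tau> has_derivative frechet_derivative ?\<tau> (at (snd d p))) (at (snd d p))"
      using smooth_on_differentiable c(2) d(2) by (auto simp: frechet_derivative_works[symmetric])
    let ?f = "f \<circ> inv_into (fst c) (snd c)"
    have f: "(?f has_derivative frechet_derivative ?f (at (snd c p))) (at (?\<tau> (snd d p)))"
      using smooth_near_differentiable[OF True c] chart_inv[OF d]
      by (auto simp: frechet_derivative_works[symmetric])
    have "((?f \<circ> ?\<tau>) has_derivative frechet_derivative ?f (at (snd c p)) \<circ> frechet_derivative ?\<tau> (at (snd d p)))
        (at (snd d p))"
      by (rule diff_chain_at[OF t f])
    then have "((f \<circ> inv_into (fst d) (snd d)) has_derivative
        frechet_derivative ?f (at (snd c p)) \<circ> frechet_derivative ?\<tau> (at (snd d p))) (at (snd d p))"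
      by (rule has_derivative_transform_within_open[where s = "snd d ` (fst d \<inter> fst c)"])
        (use c d chart_open_image[OF d(1) chart_open[OF c(1)]] chart_inv[OF c(1)] chart_inv[OF d(1)] in auto)
    from frechet_derivative_at[OF this] True show ?thesis
      by (auto simp: coord_vector_def fun_eq_iff)
  qed (simp add: coord_vector_def)
qed

lemma tangent_space_eq:
  assumes "c \<in> A" "p \<in> fst c"
  shows "tangent_space A p = range (coord_vector A c p)"
  using assms coord_vector_change[OF assms] unfolding tangent_space_def by blast

lemma subspace_tangent: "subspace (tangent_space A p)"
proof -
  obtain c where c: "c \<in> A" "p \<in> fst c" by (rule chart_exists)
  show ?thesis
    unfolding tangent_space_eq[OF c] using coord_vector_linear[OF c] by (simp add: linear_subspace_image)
qed

text \<open>A tangent vector is 0 by convention on functions not smooth near the point, so the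
  derivation rules are stated for functions smooth on a neighbourhood.\<close>

lemma tangent_apply:
  assumes X: "x \<in> tangent_space A p" and W: "open W" "p \<in> W" and f: "smooth_fun A W f" "smooth_fun A W h"
  shows tangent_apply_add: "x (\<lambda>q. f q + h q) = x f + x h"
    and tangent_apply_scale: "x (\<lambda>q. r * f q) = r * x f"
    and tangent_apply_cong: "(\<And>q. q \<in> W \<Longrightarrow> f q = k q) \<Longrightarrow> x f = x k"
proof -
  obtain c w where c: "c \<in> A" "p \<in> fst c" and x: "x = coord_vector A c p w"
    using X by (auto simp: tangent_space_def)
  have n: "smooth_near A p u" if "smooth_fun A W u" for u
    using that W by (auto simp: smooth_near_def)
  note d = smooth_near_differentiable[OF n c, unfolded comp_def]
  have "smooth_fun A W (\<lambda>q. f q + h q)" "smooth_fun A W (\<lambda>q. r * f q)"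
    using W f by (auto intro: smooth_fun_add smooth_fun_mult)
  then show "x (\<lambda>q. f q + h q) = x f + x h" "x (\<lambda>q. r * f q) = r * x f"
    using frechet_derivative_at[OF has_derivative_add[OF d[OF f(1), unfolded frechet_derivative_works]
        d[OF f(2), unfolded frechet_derivative_works]]]
      frechet_derivative_at[OF has_derivative_mult_right[OF d[OF f(1), unfolded frechet_derivative_works], of r]]
    by (auto simp: x coord_vector_def n f comp_def fun_eq_iff)
  show "x f = x k" if eq: "\<And>q. q \<in> W \<Longrightarrow> f q = k q"
  proof -
    have k: "smooth_fun A W k"
      by (rule smooth_fun_cong[OF W(1) f(1) eq])
    have "((\<lambda>y. k (inv_into (fst c) (snd c) y)) has_derivative
        frechet_derivative (\<lambda>y. f (inv_into (fst c) (snd c) y)) (at (snd c p))) (at (snd c p))"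
      by (rule has_derivative_transform_within_open[where s = "snd c ` (fst c \<inter> W)", OF d[OF f(1), unfolded frechet_derivative_works]])
        (use c W chart_open_image[OF c(1) W(1)] chart_inv[OF c(1)] eq in auto)
    from frechet_derivative_at[OF this] show ?thesis
      by (simp add: x coord_vector_def n f k comp_def)
  qed
qed

lemma smooth_vfield_tangent: "smooth_vfield A W X \<Longrightarrow> p \<in> W \<Longrightarrow> X p \<in> tangent_space A p"
  by (simp add: smooth_vfield_def)

lemma smooth_vfield_apply:
  "smooth_vfield A W X \<Longrightarrow> open W \<Longrightarrow> smooth_fun A W f \<Longrightarrow> smooth_fun A W (\<lambda>p. X p f)"
  by (simp add: smooth_vfield_def)

lemma smooth_vfield_subset: "smooth_vfield A W X \<Longrightarrow> V \<subseteq> W \<Longrightarrow> smooth_vfield A V X"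
  unfolding smooth_vfield_def by (meson order_trans subsetD)

lemma smooth_vfield_cong:
  assumes "smooth_vfield A W X" "\<And>p. p \<in> W \<Longrightarrow> X p = Y p"
  shows "smooth_vfield A W Y"
  unfolding smooth_vfield_def
proof (intro conjI ballI allI impI)
  show "Y p \<in> tangent_space A p" if "p \<in> W" for p
    using smooth_vfield_tangent[OF assms(1) that] assms(2)[OF that] by simp
  show "smooth_fun A V (\<lambda>p. Y p f)" if "open V \<and> V \<subseteq> W \<and> smooth_fun A V f" for V f
  proof (rule smooth_fun_cong)
    show "open V" "smooth_fun A V (\<lambda>p. X p f)"
      using that assms(1) by (auto simp: smooth_vfield_def)
    show "X p f = Y p f" if "p \<in> V" for p
      using that \<open>open V \<and> V \<subseteq> W \<and> smooth_fun A V f\<close> assms(2)[of p] by auto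
  qed
qed

lemma smooth_vfield_add:
  "smooth_vfield A W X \<Longrightarrow> smooth_vfield A W Y \<Longrightarrow> smooth_vfield A W (X + Y)"
  unfolding smooth_vfield_def using subspace_add[OF subspace_tangent]
  by (auto simp: plus_fun_def intro: smooth_fun_add)

lemma smooth_vfield_scale:
  "smooth_vfield A W X \<Longrightarrow> smooth_fun A W f \<Longrightarrow> smooth_vfield A W (\<lambda>p. f p *\<^sub>R X p)"
  unfolding smooth_vfield_def using subspace_scale[OF subspace_tangent]
  by (auto simp: scaleR_fun_def intro!: smooth_fun_mult intro: smooth_fun_subset)

lemma tangent_apply_const:
  assumes "x \<in> tangent_space A p" "open W" "p \<in> W"
  shows "x (\<lambda>q. r) = 0"
proof -
  obtain c w where "x = coord_vector A c p w"
    using assms(1) by (auto simp: tangent_space_def)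
  moreover have "frechet_derivative (\<lambda>y. r) (at (snd c p)) = (\<lambda>_. 0)" for c :: "('m, 'e) chart"
    by (rule frechet_derivative_at[OF has_derivative_const, symmetric])
  ultimately show ?thesis
    by (simp add: coord_vector_def comp_def)
qed

end

section \<open>Calculus of a connection over a fixed open set\<close>

locale connection_on = manifold A
  for A :: "('m::{t2_space, second_countable_topology}, 'e::euclidean_space) chart set" +
  fixes W :: "'m set" and D :: "'m connection"
  assumes open_W: "open W"
    and connection: "is_connection A D"
begin

abbreviation "field \<equiv> smooth_vfield A W"
abbreviation "func \<equiv> smooth_fun A W"

lemmas func_mult = smooth_fun_mult[OF open_W]
  and func_sum = smooth_fun_sum[OF open_W]

lemma field_apply: "field X \<Longrightarrow> func f \<Longrightarrow> func (\<lambda>p. X p f)"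
  by (rule smooth_vfield_apply[OF _ open_W])

lemmas field_add [simp] = smooth_vfield_add[of W]
  and field_scale [simp] = smooth_vfield_scale[of W]

lemma scaleR_field: "(\<lambda>q. c *\<^sub>R X q) = c *\<^sub>R X" for X :: "'m vfield"
  unfolding scaleR_fun_def[of c X] ..

lemma field_scaleR [simp]: "field X \<Longrightarrow> field (c *\<^sub>R X)"
  using field_scale[of X "\<lambda>_. c"] by (simp add: scaleR_field)

lemma field_minus [simp]: "field X \<Longrightarrow> field (- X)"
  using field_scaleR[of X "-1"] by simp

lemma field_diff [simp]: "field X \<Longrightarrow> field Y \<Longrightarrow> field (X - Y)"
  using field_add[of X "- Y"] by simp

context
  fixes X Y :: "'m vfield"
  assumes X: "field X" and Y: "field Y"
begin

lemmas connection_XY = connection[unfolded is_connection_def, THEN spec, THEN spec, THEN spec, THEN mp,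
    OF conjI[OF open_W conjI[OF X Y]]]

lemma field_D [simp]: "field (D X Y)"
  by (rule conjunct1[OF connection_XY])

text \<open>Computed fields agree with their formulas on \<open>W\<close> only, so this rule takes
  the place of rewriting whenever such a field is differentiated again.\<close>

lemma D_cong:
  "(\<And>q. q \<in> W \<Longrightarrow> X' q = X q) \<Longrightarrow> (\<And>q. q \<in> W \<Longrightarrow> Y' q = Y q) \<Longrightarrow> p \<in> W \<Longrightarrow> D X' Y' p = D X Y p"
  using conjunct1[OF conjunct2[OF conjunct2[OF connection_XY]]] by blast

end

lemma apply_const [simp]: "field X \<Longrightarrow> p \<in> W \<Longrightarrow> X p (\<lambda>q. r) = 0"
  by (rule tangent_apply_const[OF smooth_vfield_tangent open_W])

context
  fixes X Y :: "'m vfield" and p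
  assumes X [simp]: "field X" and Y [simp]: "field Y" and p [simp]: "p \<in> W"
begin

lemma D_add: "field X' \<Longrightarrow> D (X + X') Y p = D X Y p + D X' Y p" "field Y' \<Longrightarrow> D X (Y + Y') p = D X Y p + D X Y' p"
  using conjunct1[OF conjunct2[OF connection_XY[OF X Y]], rule_format, of X' Y p]
    conjunct1[OF conjunct2[OF connection_XY[OF X Y]], rule_format, of X Y' p] by simp_all

lemma D_scale: "func f \<Longrightarrow> D (\<lambda>q. f q *\<^sub>R X q) Y p = f p *\<^sub>R D X Y p"
    "func f \<Longrightarrow> D X (\<lambda>q. f q *\<^sub>R Y q) p = X p f *\<^sub>R Y p + f p *\<^sub>R D X Y p"
  using conjunct2[OF conjunct2[OF conjunct2[OF connection_XY[OF X Y]]], rule_format, of f p] by simp_all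

lemma D_scaleR: "D (c *\<^sub>R X) Y p = c *\<^sub>R D X Y p" "D X (c *\<^sub>R Y) p = c *\<^sub>R D X Y p"
  using D_scale[of "\<lambda>_. c"] by (simp_all add: scaleR_field)

lemma D_minus: "D (- X) Y p = - D X Y p" "D X (- Y) p = - D X Y p"
  using D_scaleR[of "-1"] by simp_all

end

lemma D_diff:
  assumes "field X" "field X'" "field Y" "p \<in> W"
  shows "D (X - X') Y p = D X Y p - D X' Y p" "D Y (X - X') p = D Y X p - D Y X' p"
  using D_add(1)[of X Y p "- X'"] D_add(2)[of Y X p "- X'"] D_minus[of X' Y p] D_minus[of Y X' p] assms by simp_all

lemmas D_simps = D_add D_scale D_scaleR D_minus D_diff

text \<open>On a function smooth near \<open>p\<close>, each double bracket is a signed sum of four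
  triple derivatives, and the twelve terms cancel in pairs.\<close>

lemma lie_bracket_jacobi:
  assumes X: "field X" and Y: "field Y" and Z: "field Z"
    and YZ: "field (lie_bracket A Y Z)" and ZX: "field (lie_bracket A Z X)" and XY: "field (lie_bracket A X Y)"
    and p: "p \<in> W"
  shows "lie_bracket A X (lie_bracket A Y Z) p + lie_bracket A Y (lie_bracket A Z X) p
    + lie_bracket A Z (lie_bracket A X Y) p = 0"
proof
  fix f
  show "(lie_bracket A X (lie_bracket A Y Z) p + lie_bracket A Y (lie_bracket A Z X) p
    + lie_bracket A Z (lie_bracket A X Y) p) f = 0 f"
  proof (cases "smooth_near A p f")
    case True
    then obtain V0 where V0: "open V0" "p \<in> V0" "smooth_fun A V0 f"
      by (auto simp: smooth_near_def)
    \<comment> \<open>On \<open>V\<close> the fields are smooth and so is \<open>f\<close>, so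
      brackets unfold to commutators without meeting the zero convention.\<close>
    define V where "V = V0 \<inter> W"
    have V: "open V" "p \<in> V" "smooth_fun A V f" "V \<subseteq> W"
      using V0 open_W p smooth_fun_subset[OF V0(3)] by (auto simp: V_def)
    have s: "smooth_fun A V (\<lambda>q. U q h)" if "field U" "smooth_fun A V h" for U h
      using smooth_vfield_apply[OF smooth_vfield_subset[OF that(1) V(4)] V(1) that(2)] .
    have t: "U p \<in> tangent_space A p" if "field U" for U
      using smooth_vfield_tangent[OF that p] .
    have near: "smooth_near A q h" if "q \<in> V" "smooth_fun A V h" for q h
      using that V(1) by (auto simp: smooth_near_def)
    have br: "lie_bracket A U U' q h = U q (\<lambda>q. U' q h) - U' q (\<lambda>q. U q h)"
      if "q \<in> V" "smooth_fun A V h" for U U' q h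
      using near[OF that] by (simp add: lie_bracket_def)
    have *: "lie_bracket A U (lie_bracket A U' U'') p f
        = U p (\<lambda>q. U' q (\<lambda>q. U'' q f)) - U p (\<lambda>q. U'' q (\<lambda>q. U' q f))
          - U' p (\<lambda>q. U'' q (\<lambda>q. U q f)) + U'' p (\<lambda>q. U' q (\<lambda>q. U q f))"
      if U: "field U" "field U'" "field U''" for U U' U''
    proof -
      have sm: "smooth_fun A V (\<lambda>q. U' q (\<lambda>q. U'' q f))" "smooth_fun A V (\<lambda>q. U'' q (\<lambda>q. U' q f))"
        "smooth_fun A V (\<lambda>q. U q f)"
        using U V s by auto
      have sm': "smooth_fun A V (\<lambda>q. - 1 * U'' q (\<lambda>q. U' q f))"
        using smooth_fun_mult[OF V(1) smooth_fun_const sm(2)] .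
      have "U p (\<lambda>q. lie_bracket A U' U'' q f)
          = U p (\<lambda>q. U' q (\<lambda>q. U'' q f) + - 1 * U'' q (\<lambda>q. U' q f))"
        using br V by (intro tangent_apply_cong[OF t[OF U(1)] V(1,2) smooth_fun_add[OF V(1) sm(1) sm'] sm(1), symmetric]) auto
      also have "\<dots> = U p (\<lambda>q. U' q (\<lambda>q. U'' q f)) - U p (\<lambda>q. U'' q (\<lambda>q. U' q f))"
        unfolding tangent_apply_add[OF t[OF U(1)] V(1,2) sm(1) sm']
          tangent_apply_scale[OF t[OF U(1)] V(1,2) sm(2,2)] by simp
      finally show ?thesis
        using br[OF V(2,3)] br[OF V(2) sm(3)] by simp
    qed
    show ?thesis
      using *[OF X Y Z] *[OF Y Z X] *[OF Z X Y] by simp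
  qed (simp add: lie_bracket_def)
qed

end

section \<open>Connections with skew torsion\<close>

locale skew_torsion = connection_on A W D + LC: connection_on A W Dg
  for A :: "('m::{t2_space, second_countable_topology}, 'e::euclidean_space) chart set"
    and W D Dg +
  fixes g :: "'m metric"
  assumes riemannian: "riemannian_metric A g"
    and metric_D: "metric_connection A g D"
    and levi_civita: "levi_civita A g Dg"
    and torsion3_skew: "\<lbrakk>smooth_vfield A W X; smooth_vfield A W Y; smooth_vfield A W Z; p \<in> W\<rbrakk> \<Longrightarrow>
      torsion3 A g D Y X Z p = - torsion3 A g D X Y Z p \<and> torsion3 A g D X Z Y p = - torsion3 A g D X Y Z p"
begin

abbreviation "TM \<equiv> tangent_space A"
abbreviation "Tor \<equiv> torsion A D"
abbreviation "br \<equiv> lie_bracket A"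

lemma TM_closed [simp]:
  "x \<in> TM p \<Longrightarrow> y \<in> TM p \<Longrightarrow> x + y \<in> TM p" "x \<in> TM p \<Longrightarrow> y \<in> TM p \<Longrightarrow> x - y \<in> TM p"
  "x \<in> TM p \<Longrightarrow> - x \<in> TM p" "x \<in> TM p \<Longrightarrow> c *\<^sub>R x \<in> TM p" "0 \<in> TM p"
  "(\<And>i. i \<in> I \<Longrightarrow> v i \<in> TM p) \<Longrightarrow> (\<Sum>i\<in>I. v i) \<in> TM p"
  using subspace_tangent[of p]
  by (auto intro: subspace_add subspace_diff subspace_neg subspace_scale subspace_0 subspace_sum)

lemma field_TM [simp]: "field X \<Longrightarrow> p \<in> W \<Longrightarrow> X p \<in> TM p"
  by (rule smooth_vfield_tangent)

lemmas riemannian_TM = riemannian[unfolded riemannian_metric_def, THEN conjunct1, rule_format]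

lemma g_sym: "x \<in> TM p \<Longrightarrow> y \<in> TM p \<Longrightarrow> g p x y = g p y x"
  by (rule riemannian_TM[THEN conjunct2, THEN conjunct2])

lemma g_pos: "x \<in> TM p \<Longrightarrow> x \<noteq> 0 \<Longrightarrow> g p x x > 0"
  using riemannian[unfolded riemannian_metric_def, THEN conjunct2, THEN conjunct1, rule_format] by blast

lemma g_add: "x \<in> TM p \<Longrightarrow> y \<in> TM p \<Longrightarrow> z \<in> TM p \<Longrightarrow> g p (x + y) z = g p x z + g p y z"
  "x \<in> TM p \<Longrightarrow> y \<in> TM p \<Longrightarrow> z \<in> TM p \<Longrightarrow> g p z (x + y) = g p z x + g p z y"
  using riemannian_TM[of x p y z] g_sym[of z p "x + y"] g_sym[of z p x] g_sym[of z p y] by simp_all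

lemma g_scale: "x \<in> TM p \<Longrightarrow> z \<in> TM p \<Longrightarrow> g p (c *\<^sub>R x) z = c * g p x z"
  "x \<in> TM p \<Longrightarrow> z \<in> TM p \<Longrightarrow> g p z (c *\<^sub>R x) = c * g p z x"
  using riemannian_TM[of x p x z c] g_sym[of z p "c *\<^sub>R x"] g_sym[of z p x] by simp_all

lemma g_minus: "x \<in> TM p \<Longrightarrow> z \<in> TM p \<Longrightarrow> g p (- x) z = - g p x z"
  "x \<in> TM p \<Longrightarrow> z \<in> TM p \<Longrightarrow> g p z (- x) = - g p z x"
  using g_scale[of x p z "-1"] by simp_all

lemma g_diff: "x \<in> TM p \<Longrightarrow> y \<in> TM p \<Longrightarrow> z \<in> TM p \<Longrightarrow> g p (x - y) z = g p x z - g p y z"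
  "x \<in> TM p \<Longrightarrow> y \<in> TM p \<Longrightarrow> z \<in> TM p \<Longrightarrow> g p z (x - y) = g p z x - g p z y"
  using g_add[of x p "- y" z] g_minus[of y p z] by simp_all

lemma g_zero: "x \<in> TM p \<Longrightarrow> g p 0 x = 0" "x \<in> TM p \<Longrightarrow> g p x 0 = 0"
  using g_scale[of 0 p x 0] by simp_all

lemma g_sum: "z \<in> TM p \<Longrightarrow> (\<And>i. i \<in> I \<Longrightarrow> v i \<in> TM p) \<Longrightarrow> g p (\<Sum>i\<in>I. v i) z = (\<Sum>i\<in>I. g p (v i) z)"
  by (induction I rule: infinite_finite_induct) (simp_all add: g_add g_zero)

lemma g_sum_right: "z \<in> TM p \<Longrightarrow> (\<And>i. i \<in> I \<Longrightarrow> v i \<in> TM p) \<Longrightarrow> g p z (\<Sum>i\<in>I. v i) = (\<Sum>i\<in>I. g p z (v i))"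
  by (induction I rule: infinite_finite_induct) (simp_all add: g_add g_zero)

lemmas g_simps = g_add g_scale g_minus g_diff g_zero

lemma func_g: "field X \<Longrightarrow> field Y \<Longrightarrow> func (\<lambda>p. g p (X p) (Y p))"
  using riemannian[unfolded riemannian_metric_def, THEN conjunct2, THEN conjunct2, rule_format, of W X Y] open_W
  by simp

lemma D_metric:
  assumes "field X" "field Y" "field Z" "p \<in> W"
  shows "X p (\<lambda>q. g q (Y q) (Z q)) = g p (D X Y p) (Z p) + g p (Y p) (D X Z p)"
    "X p (\<lambda>q. g q (Y q) (Z q)) = g p (Dg X Y p) (Z p) + g p (Y p) (Dg X Z p)"
  using metric_D[unfolded metric_connection_def, rule_format, of W X Y Z p]
    levi_civita[unfolded levi_civita_def metric_connection_def, THEN conjunct2, THEN conjunct1, rule_format, of W X Y Z p]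
    assms open_W by simp_all

lemma br_eq: "field X \<Longrightarrow> field Y \<Longrightarrow> p \<in> W \<Longrightarrow> br X Y p = Dg X Y p - Dg Y X p"
proof -
  assume "field X" "field Y" "p \<in> W"
  then have "torsion A Dg X Y p = 0"
    using levi_civita[unfolded levi_civita_def, THEN conjunct2, THEN conjunct2, rule_format, of W X Y p] open_W
    by simp
  then show ?thesis
    by (simp add: torsion_def)
qed

lemma field_br [simp]: "field X \<Longrightarrow> field Y \<Longrightarrow> field (br X Y)"
  by (rule smooth_vfield_cong[of W "Dg X Y - Dg Y X"]) (simp_all add: br_eq)

lemma field_Tor [simp]: "field X \<Longrightarrow> field Y \<Longrightarrow> field (Tor X Y)"
  by (simp add: torsion_def)

lemma Tor_eq: "field X \<Longrightarrow> field Y \<Longrightarrow> p \<in> W \<Longrightarrow>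
    Tor X Y p = (D X Y p - Dg X Y p) - (D Y X p - Dg Y X p)"
  by (simp add: torsion_def br_eq)

lemma g_Tor_skew:
  assumes "field X" "field Y" "field Z" "p \<in> W"
  shows "g p (Tor Y X p) (Z p) = - g p (Tor X Y p) (Z p)" "g p (Tor X Z p) (Y p) = - g p (Tor X Y p) (Z p)"
  using torsion3_skew[OF assms] unfolding torsion3_def by simp_all

lemma eq_zeroI:
  assumes "field X" "p \<in> W" "\<And>Z. field Z \<Longrightarrow> g p (X p) (Z p) = 0"
  shows "X p = 0"
  using g_pos[of "X p" p] assms(3)[OF assms(1)] assms(1,2) by force

lemma br_tensor:
  assumes [simp]: "field X" "field Y" "field Z" "p \<in> W"
  shows "br Y X p = - br X Y p"
    and "func f \<Longrightarrow> br (\<lambda>q. f q *\<^sub>R X q) Y p = f p *\<^sub>R br X Y p - Y p f *\<^sub>R X p"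
    and "br (X + Z) Y p = br X Y p + br Z Y p"
  by (simp_all add: br_eq LC.D_simps algebra_simps)

text \<open>The difference is antisymmetric in its last two and symmetric in its first two arguments.\<close>

lemma Dg_eq:
  assumes [simp]: "field X" "field Y" "p \<in> W"
  shows "Dg X Y p = D X Y p - (1/2) *\<^sub>R Tor X Y p"
proof -
  define K where "K = (\<lambda>X Y. D X Y - Dg X Y - (1/2) *\<^sub>R Tor X Y)"
  have K [simp]: "field (K X Y)" if [simp]: "field X" "field Y" for X Y
    by (simp add: K_def)
  have K_apply: "K X Y p = D X Y p - Dg X Y p - (1/2) *\<^sub>R Tor X Y p" for X Y
    by (simp only: K_def minus_apply scaleR_fun_def[of _ "Tor X Y"])
  have skew: "g p (K X Y p) (Z p) = - g p (K X Z p) (Y p)" if [simp]: "field X" "field Y" "field Z" for X Y Z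
    using D_metric[of X Y Z p] g_Tor_skew(2)[of X Y Z p]
    by (simp add: K_apply g_simps g_sym[of "Y p" p])
  have T: "Tor Y X p = - Tor X Y p" if [simp]: "field X" "field Y" for X Y
    using Tor_eq[of X Y p] Tor_eq[of Y X p] by simp
  have sym: "K Y X p = K X Y p" if [simp]: "field X" "field Y" for X Y
    using Tor_eq[of X Y p] by (simp add: K_apply T[of X Y] algebra_simps flip: scaleR_2)
  have "g p (K X Y p) (Z p) = 0" if [simp]: "field Z" for Z
  proof -
    have "g p (K X Y p) (Z p) = - g p (K Z X p) (Y p)"
      by (simp add: skew[of X Y Z] sym[of X Z])
    also have "\<dots> = g p (K Y Z p) (X p)"
      by (simp add: skew[of Z X Y] sym[of Z Y])
    also have "\<dots> = - g p (K X Y p) (Z p)"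
      by (simp add: skew[of Y Z X] sym[of X Y])
    finally show ?thesis by simp
  qed
  then have "K X Y p = 0"
    by (intro eq_zeroI) simp_all
  then show ?thesis
    by (simp add: K_apply algebra_simps)
qed

lemma Tor_swap: "field X \<Longrightarrow> field Y \<Longrightarrow> p \<in> W \<Longrightarrow> Tor Y X p = - Tor X Y p"
  using Tor_eq[of X Y p] Tor_eq[of Y X p] by simp

lemma Tor_cong:
  assumes "field X" "field Y" "\<And>q. q \<in> W \<Longrightarrow> X' q = X q" "\<And>q. q \<in> W \<Longrightarrow> Y' q = Y q" "p \<in> W"
  shows "Tor X' Y' p = Tor X Y p"
proof -
  have "field X'" "field Y'"
    using smooth_vfield_cong[of W X X'] smooth_vfield_cong[of W Y Y'] assms by simp_all
  then show ?thesis
    using assms by (simp add: Tor_eq D_cong[of X Y X' Y'] D_cong[of Y X Y' X'] LC.D_cong[of X Y X' Y'] LC.D_cong[of Y X Y' X'])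
qed

lemma Tor_tensor:
  assumes [simp]: "field X" "field Y" "p \<in> W"
  shows "field X' \<Longrightarrow> Tor (X + X') Y p = Tor X Y p + Tor X' Y p"
    "field Y' \<Longrightarrow> Tor X (Y + Y') p = Tor X Y p + Tor X Y' p"
    "field X' \<Longrightarrow> Tor (X - X') Y p = Tor X Y p - Tor X' Y p"
    "field Y' \<Longrightarrow> Tor X (Y - Y') p = Tor X Y p - Tor X Y' p"
    "func f \<Longrightarrow> Tor (\<lambda>q. f q *\<^sub>R X q) Y p = f p *\<^sub>R Tor X Y p"
    "func f \<Longrightarrow> Tor X (\<lambda>q. f q *\<^sub>R Y q) p = f p *\<^sub>R Tor X Y p"
    "Tor (c *\<^sub>R X) Y p = c *\<^sub>R Tor X Y p"
    "Tor X (c *\<^sub>R Y) p = c *\<^sub>R Tor X Y p"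
  by (simp_all add: Tor_eq D_simps LC.D_simps algebra_simps)

section \<open>The derivative of the torsion and the curvature identities\<close>

definition DT :: "'m vfield \<Rightarrow> 'm vfield \<Rightarrow> 'm vfield \<Rightarrow> 'm vfield" where
  "DT X Y Z = D X (Tor Y Z) - Tor (D X Y) Z - Tor Y (D X Z)"

lemma field_curv [simp]:
  "field X \<Longrightarrow> field Y \<Longrightarrow> field Z \<Longrightarrow> field (curv A D X Y Z)"
  "field X \<Longrightarrow> field Y \<Longrightarrow> field Z \<Longrightarrow> field (curv A Dg X Y Z)"
  "field X \<Longrightarrow> field Y \<Longrightarrow> field Z \<Longrightarrow> field (DT X Y Z)"
  by (simp_all add: curv_def DT_def)

text \<open>Expand the torsions by their definition and sum cyclically: the second derivatives
  assemble into curvature, the terms of the form \<open>Tor (D X Y) Z\<close> and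
  \<open>D Z (br X Y)\<close> cancel, and the double brackets vanish by the Jacobi identity.\<close>

lemma first_bianchi:
  assumes [simp]: "field X" "field Y" "field Z" "p \<in> W"
  shows "curv A D X Y Z p + curv A D Y Z X p + curv A D Z X Y p
    = DT X Y Z p + DT Y Z X p + DT Z X Y p + Tor (Tor X Y) Z p + Tor (Tor Y Z) X p + Tor (Tor Z X) Y p"
proof -
  have T: "Tor (Tor X Y) Z p = Tor (D X Y) Z p - Tor (D Y X) Z p
      - (D (br X Y) Z p - D Z (br X Y) p + br Z (br X Y) p)"
    if [simp]: "field X" "field Y" "field Z" for X Y Z
  proof -
    have "Tor (Tor X Y) Z p = Tor (D X Y) Z p - Tor (D Y X) Z p - Tor (br X Y) Z p"
      by (simp add: torsion_def[of A D X Y] Tor_tensor)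
    then show ?thesis
      using br_tensor(1)[of "br X Y" Z Z p] by (simp add: torsion_def[of A D "br X Y" Z])
  qed
  have DT: "DT X Y Z p = D X (D Y Z) p - D X (D Z Y) p - D X (br Y Z) p - Tor (D X Y) Z p + Tor (D X Z) Y p"
    if [simp]: "field X" "field Y" "field Z" for X Y Z
    using Tor_swap[of "D X Z" Y p] by (simp add: DT_def torsion_def[of A D Y Z] D_simps)
  have "br X (br Y Z) p + br Y (br Z X) p + br Z (br X Y) p = 0"
    by (rule lie_bracket_jacobi) simp_all
  then show ?thesis
    by (simp add: curv_def DT T algebra_simps)
qed

lemma curv_Dg:
  assumes [simp]: "field X" "field Y" "field Z" "p \<in> W"
  shows "curv A Dg X Y Z p = curv A D X Y Z p - (1/2) *\<^sub>R (DT X Y Z p - DT Y X Z p)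
    - (1/2) *\<^sub>R Tor (Tor X Y) Z p + (1/4) *\<^sub>R (Tor X (Tor Y Z) p - Tor Y (Tor X Z) p)"
proof -
  have *: "Dg X (Dg Y Z) p = D X (D Y Z) p - (1/2) *\<^sub>R D X (Tor Y Z) p
      - (1/2) *\<^sub>R (Tor X (D Y Z) p - (1/2) *\<^sub>R Tor X (Tor Y Z) p)"
    if [simp]: "field X" "field Y" "field Z" for X Y Z
  proof -
    \<comment> \<open>\<open>Dg Y Z\<close> equals \<open>U\<close> only on \<open>W\<close>; the
      congruence rules carry this equality under the outer \<open>D\<close> and
      \<open>Tor\<close>.\<close>
    define U where "U = D Y Z - (1/2) *\<^sub>R Tor Y Z"
    have U: "field U" "\<And>q. q \<in> W \<Longrightarrow> Dg Y Z q = U q"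
      by (simp_all add: U_def Dg_eq scaleR_fun_def[of _ "Tor Y Z"])
    have "Dg X (Dg Y Z) p = D X (Dg Y Z) p - (1/2) *\<^sub>R Tor X (Dg Y Z) p"
      by (simp add: Dg_eq)
    also have "D X (Dg Y Z) p = D X U p"
      using U assms(4) by (intro D_cong) auto
    also have "Tor X (Dg Y Z) p = Tor X U p"
      using U assms(4) by (intro Tor_cong) auto
    also have "D X U p = D X (D Y Z) p - (1/2) *\<^sub>R D X (Tor Y Z) p"
      unfolding U_def by (simp add: D_diff D_scaleR)
    also have "Tor X U p = Tor X (D Y Z) p - (1/2) *\<^sub>R Tor X (Tor Y Z) p"
      unfolding U_def by (simp add: Tor_tensor)
    finally show ?thesis .
  qed
  have T: "Tor (Tor X Y) Z p = Tor (D X Y) Z p - Tor (D Y X) Z p - Tor (br X Y) Z p"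
    by (simp add: torsion_def[of A D X Y] Tor_tensor)
  have s: "Tor Y (D X Z) p = - Tor (D X Z) Y p" "Tor X (D Y Z) p = - Tor (D Y Z) X p"
    using Tor_swap[of "D X Z" Y p] Tor_swap[of "D Y Z" X p] by simp_all
  have "curv A Dg X Y Z p = Dg X (Dg Y Z) p - Dg Y (Dg X Z) p - Dg (br X Y) Z p"
    by (simp add: curv_def)
  also have "\<dots> = curv A D X Y Z p - (1/2) *\<^sub>R (DT X Y Z p - DT Y X Z p)
    - (1/2) *\<^sub>R Tor (Tor X Y) Z p + (1/4) *\<^sub>R (Tor X (Tor Y Z) p - Tor Y (Tor X Z) p)"
    by (simp add: * Dg_eq[of "br X Y" Z] curv_def DT_def T s algebra_simps)
  finally show ?thesis .
qed

text \<open>Differentiate the antisymmetry of the torsion 3-form along \<open>X\<close>. Metric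
  compatibility expresses \<open>DT\<close> through that derivative and through torsion terms that
  are themselves skew.\<close>

lemma g_DT_skew:
  assumes [simp]: "field X" "field Y" "field Z" "field V" "p \<in> W"
  shows "g p (DT X Y V p) (Z p) = - g p (DT X Y Z p) (V p)"
proof -
  have *: "g p (DT X Y Z p) (V p) = X p (\<lambda>q. g q (Tor Y Z q) (V q)) - g p (Tor Y Z p) (D X V p)
      - g p (Tor (D X Y) Z p) (V p) - g p (Tor Y (D X Z) p) (V p)" if [simp]: "field Z" "field V" for Z V
    using D_metric(1)[of X "Tor Y Z" V p] by (simp add: DT_def g_simps)
  have f: "func (\<lambda>q. g q (Tor Y Z q) (V q))"
    by (simp add: func_g)
  have "X p (\<lambda>q. g q (Tor Y V q) (Z q)) = X p (\<lambda>q. - 1 * g q (Tor Y Z q) (V q))"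
    \<comment> \<open>\<open>h\<close> is a placeholder: the rule shares its assumptions with the
      sum rule and therefore carries a second smooth function.\<close>
    by (rule tangent_apply_cong[OF field_TM[of X p] open_W, where h = "\<lambda>_. 0"])
      (simp_all add: func_g g_Tor_skew(2)[of Y Z V])
  also have "\<dots> = - X p (\<lambda>q. g q (Tor Y Z q) (V q))"
    using tangent_apply_scale[OF field_TM[of X p] open_W _ f f, of "-1"] by simp
  finally show ?thesis
    using g_Tor_skew(2)[of Y Z "D X V" p] g_Tor_skew(2)[of "D X Y" Z V p] g_Tor_skew(2)[of Y "D X Z" V p]
    by (simp add: *)
qed

text \<open>Linearity over functions for one slot, evaluated at \<open>p\<close>. The last clause is
  there because fields are total, while a frame expansion agrees with its field only on
  \<open>W\<close>. In a frame, the clauses make \<open>F X\<close> depend on \<open>X p\<close>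
  alone.\<close>

definition tensor_at :: "'m \<Rightarrow> ('m vfield \<Rightarrow> 'b::real_vector) \<Rightarrow> bool" where
  "tensor_at p F \<longleftrightarrow>
    (\<forall>X Y. field X \<longrightarrow> field Y \<longrightarrow> F (X + Y) = F X + F Y) \<and>
    (\<forall>X f. field X \<longrightarrow> func f \<longrightarrow> F (\<lambda>q. f q *\<^sub>R X q) = f p *\<^sub>R F X) \<and>
    (\<forall>X X'. field X \<longrightarrow> field X' \<longrightarrow> (\<forall>q\<in>W. X' q = X q) \<longrightarrow> F X' = F X)"

text \<open>Antisymmetry carries tensoriality from one slot to another, so only one slot of each
  antisymmetric pair has to be computed.\<close>

lemma tensor_at_minus:
  assumes "tensor_at p F" "\<And>X. field X \<Longrightarrow> G X = - F X"
  shows "tensor_at p G"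
  unfolding tensor_at_def
proof (intro conjI allI impI)
  fix X Y f
  assume X: "field X"
  show "G (X + Y) = G X + G Y" if "field Y"
    using assms(1)[unfolded tensor_at_def, THEN conjunct1, rule_format, OF X that]
    unfolding assms(2)[OF field_add[OF X that]] assms(2)[OF X] assms(2)[OF that] by simp
  show "G (\<lambda>q. f q *\<^sub>R X q) = f p *\<^sub>R G X" if "func f"
    using assms(1)[unfolded tensor_at_def, THEN conjunct2, THEN conjunct1, rule_format, OF X that]
    unfolding assms(2)[OF field_scale[OF X that]] assms(2)[OF X] by simp
  show "G Y = G X" if "field Y" "\<forall>q\<in>W. Y q = X q"
    using assms(1)[unfolded tensor_at_def, THEN conjunct2, THEN conjunct2, rule_format, OF X that(1)] that(2)
    unfolding assms(2)[OF X] assms(2)[OF that(1)] by simp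
qed

lemma tensor_atD:
  assumes "tensor_at p F"
  shows "field X \<Longrightarrow> field Y \<Longrightarrow> F (X + Y) = F X + F Y"
    "field X \<Longrightarrow> func h \<Longrightarrow> F (\<lambda>q. h q *\<^sub>R X q) = h p *\<^sub>R F X"
    "field X \<Longrightarrow> field X' \<Longrightarrow> (\<And>q. q \<in> W \<Longrightarrow> X' q = X q) \<Longrightarrow> F X' = F X"
  using assms unfolding tensor_at_def by blast+

lemma tensor_Tor:
  assumes [simp]: "field Y" "p \<in> W"
  shows "tensor_at p (\<lambda>X. Tor X Y p)" "tensor_at p (\<lambda>X. Tor Y X p)"
  unfolding tensor_at_def by (auto simp: Tor_tensor intro!: Tor_cong)

context
  fixes Y Z :: "'m vfield" and p
  assumes Y [simp]: "field Y" and Z [simp]: "field Z" and p [simp]: "p \<in> W"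
begin

lemma tensor_curv1: "tensor_at p (\<lambda>X. curv A D X Y Z p)"
  unfolding tensor_at_def
proof (intro conjI allI impI)
  fix X X' f
  assume X [simp]: "field X"
  have *: "curv A D V Y Z p = D V (D Y Z) p - D Y (D V Z) p - D (br V Y) Z p" for V
    by (simp add: curv_def)
  show "curv A D (X + X') Y Z p = curv A D X Y Z p + curv A D X' Y Z p" if [simp]: "field X'"
  proof -
    have "D Y (D (X + X') Z) p = D Y (D X Z + D X' Z) p" "D (br (X + X') Y) Z p = D (br X Y + br X' Y) Z p"
      by (rule D_cong; simp add: D_add br_tensor(3))+
    then show ?thesis
      by (simp add: * D_simps)
  qed
  show "curv A D (\<lambda>q. f q *\<^sub>R X q) Y Z p = f p *\<^sub>R curv A D X Y Z p" if [simp]: "func f"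
  proof -
    have [simp]: "func (\<lambda>q. Y q f)"
      by (simp add: field_apply)
    \<comment> \<open>The term with \<open>Y p f\<close> from differentiating \<open>f\<close> times
      \<open>D X Z\<close> cancels the one that the bracket contributes.\<close>
    have "D Y (D (\<lambda>q. f q *\<^sub>R X q) Z) p = D Y (\<lambda>q. f q *\<^sub>R D X Z q) p"
      "D (br (\<lambda>q. f q *\<^sub>R X q) Y) Z p = D ((\<lambda>q. f q *\<^sub>R br X Y q) - (\<lambda>q. Y q f *\<^sub>R X q)) Z p"
      by (rule D_cong; simp add: D_scale br_tensor(2)[of X Y X])+
    then show ?thesis
      by (simp add: * D_simps algebra_simps)
  qed
  show "curv A D X' Y Z p = curv A D X Y Z p" if [simp]: "field X'" and e: "\<forall>q\<in>W. X' q = X q"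
  proof -
    have b: "br X' Y q = br X Y q" if "q \<in> W" for q
      using that e by (simp add: br_eq LC.D_cong[of X Y X' Y] LC.D_cong[of Y X Y X'])
    have "D (br X' Y) Z p = D (br X Y) Z p" "D X' (D Y Z) p = D X (D Y Z) p" "D Y (D X' Z) p = D Y (D X Z) p"
      by (rule D_cong; simp add: b e D_cong[of X Z X' Z])+
    then show ?thesis
      by (simp add: *)
  qed
qed

lemma curv_swap:
  assumes X [simp]: "field X"
  shows "curv A D X Y Z p = - curv A D Y X Z p"
proof -
  have "D (br Y X) Z p = D (- br X Y) Z p"
    by (rule D_cong) (simp_all add: br_tensor(1)[of X Y X])
  then show ?thesis
    by (simp add: curv_def D_simps)
qed

lemma tensor_curv2: "tensor_at p (\<lambda>X. curv A D Y X Z p)"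
  by (rule tensor_at_minus[OF tensor_curv1]) (simp add: curv_swap)

lemma tensor_curv3: "tensor_at p (\<lambda>X. curv A D Y Z X p)"
  unfolding tensor_at_def
proof (intro conjI allI impI)
  fix X X' f
  assume X [simp]: "field X"
  have *: "curv A D Y Z V p = D Y (D Z V) p - D Z (D Y V) p - D (br Y Z) V p" for V
    by (simp add: curv_def)
  show "curv A D Y Z (X + X') p = curv A D Y Z X p + curv A D Y Z X' p" if [simp]: "field X'"
  proof -
    have "D Y (D Z (X + X')) p = D Y (D Z X + D Z X') p" "D Z (D Y (X + X')) p = D Z (D Y X + D Y X') p"
      by (rule D_cong; simp add: D_add)+
    then show ?thesis
      by (simp add: * D_simps)
  qed
  show "curv A D Y Z (\<lambda>q. f q *\<^sub>R X q) p = f p *\<^sub>R curv A D Y Z X p" if [simp]: "func f"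
  proof -
    have [simp]: "func (\<lambda>q. Y q f)" "func (\<lambda>q. Z q f)"
      by (simp_all add: field_apply)
    have "D Y (D Z (\<lambda>q. f q *\<^sub>R X q)) p = D Y ((\<lambda>q. Z q f *\<^sub>R X q) + (\<lambda>q. f q *\<^sub>R D Z X q)) p"
      "D Z (D Y (\<lambda>q. f q *\<^sub>R X q)) p = D Z ((\<lambda>q. Y q f *\<^sub>R X q) + (\<lambda>q. f q *\<^sub>R D Y X q)) p"
      by (rule D_cong; simp add: D_scale)+
    \<comment> \<open>The two second derivatives of \<open>f\<close> differ by its derivative along
      the bracket, which the third term of the curvature removes.\<close>
    moreover have "smooth_near A p f"
      using open_W unfolding smooth_near_def by (intro exI[of _ W]) simp
    then have "Y p (\<lambda>q. Z q f) = br Y Z p f + Z p (\<lambda>q. Y q f)"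
      by (simp add: lie_bracket_def)
    ultimately show ?thesis
      by (simp add: * D_simps algebra_simps)
  qed
  show "curv A D Y Z X' p = curv A D Y Z X p" if [simp]: "field X'" and e: "\<forall>q\<in>W. X' q = X q"
  proof -
    have "D (br Y Z) X' p = D (br Y Z) X p" "D Y (D Z X') p = D Y (D Z X) p" "D Z (D Y X') p = D Z (D Y X) p"
      by (rule D_cong; simp add: e D_cong[of Y X Y X'] D_cong[of Z X Z X'])+
    then show ?thesis
      by (simp add: *)
  qed
qed

lemma tensor_DT1: "tensor_at p (\<lambda>X. DT X Y Z p)"
  unfolding tensor_at_def
proof (intro conjI allI impI)
  fix X X' f
  assume X [simp]: "field X"
  have *: "DT V Y Z p = D V (Tor Y Z) p - Tor (D V Y) Z p - Tor Y (D V Z) p" for V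
    by (simp add: DT_def)
  show "DT (X + X') Y Z p = DT X Y Z p + DT X' Y Z p" if [simp]: "field X'"
  proof -
    have "Tor (D (X + X') Y) Z p = Tor (D X Y + D X' Y) Z p" "Tor Y (D (X + X') Z) p = Tor Y (D X Z + D X' Z) p"
      by (rule Tor_cong; simp add: D_add)+
    then show ?thesis
      by (simp add: * D_simps Tor_tensor)
  qed
  show "DT (\<lambda>q. f q *\<^sub>R X q) Y Z p = f p *\<^sub>R DT X Y Z p" if [simp]: "func f"
  proof -
    have "Tor (D (\<lambda>q. f q *\<^sub>R X q) Y) Z p = Tor (\<lambda>q. f q *\<^sub>R D X Y q) Z p"
      "Tor Y (D (\<lambda>q. f q *\<^sub>R X q) Z) p = Tor Y (\<lambda>q. f q *\<^sub>R D X Z q) p"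
      by (rule Tor_cong; simp add: D_scale)+
    then show ?thesis
      by (simp add: * D_simps Tor_tensor algebra_simps)
  qed
  show "DT X' Y Z p = DT X Y Z p" if [simp]: "field X'" and e: "\<forall>q\<in>W. X' q = X q"
  proof -
    have "Tor (D X' Y) Z p = Tor (D X Y) Z p" "Tor Y (D X' Z) p = Tor Y (D X Z) p"
      by (rule Tor_cong; simp add: e D_cong[of X Z X' Z] D_cong[of X Y X' Y])+
    moreover have "D X' (Tor Y Z) p = D X (Tor Y Z) p"
      by (rule D_cong; simp add: e)
    ultimately show ?thesis
      by (simp add: *)
  qed
qed

text \<open>The term with \<open>Y p f\<close> from differentiating the torsion cancels the one from
  \<open>D Y\<close> of the rescaled field inside the torsion.\<close>

lemma tensor_DT2: "tensor_at p (\<lambda>X. DT Y X Z p)"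
  unfolding tensor_at_def
proof (intro conjI allI impI)
  fix X X' f
  assume X [simp]: "field X"
  have *: "DT Y V Z p = D Y (Tor V Z) p - Tor (D Y V) Z p - Tor V (D Y Z) p" for V
    by (simp add: DT_def)
  show "DT Y (X + X') Z p = DT Y X Z p + DT Y X' Z p" if [simp]: "field X'"
  proof -
    have "D Y (Tor (X + X') Z) p = D Y (Tor X Z + Tor X' Z) p"
      by (rule D_cong; simp add: Tor_tensor)
    moreover have "Tor (D Y (X + X')) Z p = Tor (D Y X + D Y X') Z p"
      by (rule Tor_cong; simp add: D_add)
    ultimately show ?thesis
      by (simp add: * D_simps Tor_tensor)
  qed
  show "DT Y (\<lambda>q. f q *\<^sub>R X q) Z p = f p *\<^sub>R DT Y X Z p" if [simp]: "func f"
  proof -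
    have [simp]: "func (\<lambda>q. Y q f)"
      by (simp add: field_apply)
    have "D Y (Tor (\<lambda>q. f q *\<^sub>R X q) Z) p = D Y (\<lambda>q. f q *\<^sub>R Tor X Z q) p"
      by (rule D_cong; simp add: Tor_tensor)
    moreover have "Tor (D Y (\<lambda>q. f q *\<^sub>R X q)) Z p = Tor ((\<lambda>q. Y q f *\<^sub>R X q) + (\<lambda>q. f q *\<^sub>R D Y X q)) Z p"
      by (rule Tor_cong; simp add: D_scale)
    ultimately show ?thesis
      by (simp add: * D_simps Tor_tensor algebra_simps)
  qed
  show "DT Y X' Z p = DT Y X Z p" if [simp]: "field X'" and e: "\<forall>q\<in>W. X' q = X q"
  proof -
    have "D Y (Tor X' Z) p = D Y (Tor X Z) p"
      by (rule D_cong; simp add: e Tor_cong[of X Z X' Z])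
    moreover have "Tor (D Y X') Z p = Tor (D Y X) Z p" "Tor X' (D Y Z) p = Tor X (D Y Z) p"
      by (rule Tor_cong; simp add: e D_cong[of Y X Y X'])+
    ultimately show ?thesis
      by (simp add: *)
  qed
qed

lemma DT_swap:
  assumes X [simp]: "field X"
  shows "DT Y Z X p = - DT Y X Z p"
proof -
  have "D Y (Tor Z X) p = D Y (- Tor X Z) p"
    by (rule D_cong; simp add: Tor_swap[of X Z])
  then show ?thesis
    using Tor_swap[of "D Y Z" X p] Tor_swap[of Z "D Y X" p] by (simp add: DT_def D_simps)
qed

lemma tensor_DT3: "tensor_at p (\<lambda>X. DT Y Z X p)"
  by (rule tensor_at_minus[OF tensor_DT2]) (simp add: DT_swap)

end

end

section \<open>Components in an orthonormal frame\<close>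

locale framed_torsion = skew_torsion A W D Dg g
  for A :: "('m::{t2_space, second_countable_topology}, 'e::euclidean_space) chart set"
    and W D Dg g +
  fixes E :: "'e \<Rightarrow> 'm vfield"
  assumes E_field [simp]: "b \<in> Basis \<Longrightarrow> smooth_vfield A W (E b)"
    and E_orthonormal: "\<lbrakk>p \<in> W; b \<in> Basis; c \<in> Basis\<rbrakk> \<Longrightarrow> g p (E b p) (E c p) = (if b = c then 1 else 0)"
begin

text \<open>Orthonormality gives independence, and a dimension count gives spanning. The count is
  made in the model space: a chart pulls the frame back to vectors \<open>u b\<close>, and the
  linear map \<open>L\<close> taking the standard basis to them is injective, hence
  surjective.\<close>

lemma frame_expansion:
  assumes p [simp]: "p \<in> W" and x [simp]: "x \<in> TM p"
  shows "(\<Sum>b\<in>Basis. g p x (E b p) *\<^sub>R E b p) = x"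
proof -
  have coeff: "g p (\<Sum>b\<in>Basis. (w \<bullet> b) *\<^sub>R E b p) (E c p) = w \<bullet> c" if [simp]: "c \<in> Basis" for w c
    by (simp add: g_sum g_scale E_orthonormal if_distrib[of "\<lambda>x. _ * x"] cong: if_cong)
  obtain c where c: "c \<in> A" "p \<in> fst c" by (rule chart_exists)
  note \<Phi> = coord_vector_linear[OF c]
  have "\<exists>u. coord_vector A c p u = E b p" if "b \<in> Basis" for b
    using field_TM[OF E_field[OF that] p] unfolding tangent_space_eq[OF c] by force
  then obtain u where u: "\<And>b. b \<in> Basis \<Longrightarrow> coord_vector A c p (u b) = E b p"
    by metis
  define L where "L w = (\<Sum>b\<in>Basis. (w \<bullet> b) *\<^sub>R u b)" for w
  have L: "linear L"
    by (rule linearI) (simp_all add: L_def inner_simps scaleR_add_left sum.distrib scaleR_sum_right)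
  have \<Phi>L: "coord_vector A c p (L w) = (\<Sum>b\<in>Basis. (w \<bullet> b) *\<^sub>R E b p)" for w
    by (simp add: L_def linear_sum[OF \<Phi>] linear_scale[OF \<Phi>] u)
  have "w = 0" if "L w = 0" for w
  proof (rule euclidean_eqI)
    fix b :: 'e assume "b \<in> Basis"
    then show "w \<bullet> b = 0 \<bullet> b"
      using coeff[of b w] \<Phi>L[of w] that by (simp add: linear_0[OF \<Phi>] g_zero)
  qed
  then have "inj L"
    by (simp add: linear_injective_0[OF L])
  then have "surj L"
    by (rule linear_injective_imp_surjective[OF L _ refl])
  moreover obtain v where v: "x = coord_vector A c p v"
    using x unfolding tangent_space_eq[OF c] by blast
  ultimately obtain w where "v = L w"
    by (metis surjD)
  then have xw: "x = (\<Sum>b\<in>Basis. (w \<bullet> b) *\<^sub>R E b p)"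
    by (simp add: v \<Phi>L)
  show ?thesis
    unfolding xw by (simp add: coeff)
qed

text \<open>Extension of a component vector with constant coefficients in the frame. At each point
  of \<open>W\<close> its value is inverse to \<open>co\<close>, isometrically.\<close>

definition vf :: "'e \<Rightarrow> 'm vfield" where
  "vf v = (\<lambda>q. \<Sum>b\<in>Basis. (v \<bullet> b) *\<^sub>R E b q)"

definition co :: "'m \<Rightarrow> 'm tangent \<Rightarrow> 'e" where
  "co p x = (\<Sum>b\<in>Basis. g p x (E b p) *\<^sub>R b)"

lemma field_combination:
  assumes "\<And>b. b \<in> Basis \<Longrightarrow> func (f b)" "finite B" "B \<subseteq> Basis"
  shows "field (\<lambda>q. \<Sum>b\<in>B. f b q *\<^sub>R E b q)"
  using assms(2,3)
proof (induction B rule: finite_induct)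
  case empty
  obtain b :: 'e where "b \<in> Basis" using nonempty_Basis by blast
  then show ?case
    using field_scale[of "E b" "\<lambda>_. 0"] by (simp add: zero_fun_def)
next
  case (insert b B)
  then show ?case
    using field_add[of "\<lambda>q. f b q *\<^sub>R E b q" "\<lambda>q. \<Sum>b\<in>B. f b q *\<^sub>R E b q"] assms(1)
    by (simp add: plus_fun_def)
qed

lemma field_vf [simp]: "field (vf v)"
  unfolding vf_def by (rule field_combination) simp_all

lemma vf_Basis: "b \<in> Basis \<Longrightarrow> vf b = E b"
  by (simp add: vf_def inner_Basis if_distrib[of "\<lambda>x. x *\<^sub>R _"] cong: if_cong)

lemma vf_add: "vf (v + w) = vf v + vf w"
  by (simp add: vf_def fun_eq_iff[where 'a = 'm] inner_simps scaleR_add_left sum.distrib)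

lemma vf_scale: "vf (c *\<^sub>R v) = (\<lambda>q. c *\<^sub>R vf v q)"
  by (simp add: vf_def scaleR_sum_right)

context
  fixes p assumes p [simp]: "p \<in> W"
begin

lemma co_linear: "x \<in> TM p \<Longrightarrow> y \<in> TM p \<Longrightarrow> co p (x + y) = co p x + co p y"
  "x \<in> TM p \<Longrightarrow> co p (c *\<^sub>R x) = c *\<^sub>R co p x"
  "x \<in> TM p \<Longrightarrow> co p (- x) = - co p x"
  "x \<in> TM p \<Longrightarrow> y \<in> TM p \<Longrightarrow> co p (x - y) = co p x - co p y"
  by (simp_all add: co_def g_simps scaleR_add_left scaleR_diff_left sum.distrib sum_subtractf sum_negf scaleR_sum_right)

lemma vf_co: "x \<in> TM p \<Longrightarrow> vf (co p x) p = x"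
  using frame_expansion[of p x] by (simp add: vf_def co_def)

lemma co_inner_Basis: "b \<in> Basis \<Longrightarrow> co p x \<bullet> b = g p x (E b p)"
  by (simp add: co_def)

lemma co_vf [simp]: "co p (vf v p) = v"
proof (rule euclidean_eqI)
  fix b :: 'e assume b [simp]: "b \<in> Basis"
  show "co p (vf v p) \<bullet> b = v \<bullet> b"
    by (simp add: co_inner_Basis)
      (simp add: vf_def g_sum g_scale E_orthonormal if_distrib[of "\<lambda>x. _ * x"] cong: if_cong)
qed

lemma co_E [simp]: "b \<in> Basis \<Longrightarrow> co p (E b p) = b"
  using co_vf[of b] by (simp add: vf_Basis)

lemma co_inner: "x \<in> TM p \<Longrightarrow> y \<in> TM p \<Longrightarrow> co p x \<bullet> co p y = g p x y"
proof -
  assume [simp]: "x \<in> TM p" "y \<in> TM p"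
  have "g p x y = g p x (vf (co p y) p)"
    by (simp add: vf_co)
  also have "\<dots> = (\<Sum>b\<in>Basis. (co p y \<bullet> b) * (co p x \<bullet> b))"
    by (simp add: vf_def g_sum_right g_scale co_inner_Basis)
  finally show ?thesis
    by (subst euclidean_inner) (simp add: mult.commute)
qed

lemma tensor_at_combination:
  fixes F :: "'m vfield \<Rightarrow> 'b::real_vector"
  assumes F: "tensor_at p F" and f: "\<And>b. b \<in> Basis \<Longrightarrow> func (f b)" and B: "finite B" "B \<subseteq> Basis"
  shows "F (\<lambda>q. \<Sum>b\<in>B. f b q *\<^sub>R E b q) = (\<Sum>b\<in>B. f b p *\<^sub>R F (E b))"
proof -
  have F_scale: "field X \<Longrightarrow> func h \<Longrightarrow> F (\<lambda>q. h q *\<^sub>R X q) = h p *\<^sub>R F X"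
    and F_add: "field X \<Longrightarrow> field Y \<Longrightarrow> F (X + Y) = F X + F Y" for X Y h
    by (fact tensor_atD[OF F])+
  show ?thesis
    using B
  proof (induction B rule: finite_induct)
    case empty
    obtain b :: 'e where "b \<in> Basis" using nonempty_Basis by blast
    then show ?case
      using F_scale[of "E b" "\<lambda>_. 0"] by (simp add: zero_fun_def)
  next
    case (insert b B)
    have eq: "(\<lambda>q. \<Sum>b\<in>insert b B. f b q *\<^sub>R E b q) = (\<lambda>q. f b q *\<^sub>R E b q) + (\<lambda>q. \<Sum>b\<in>B. f b q *\<^sub>R E b q)"
      using insert by (simp add: plus_fun_def)
    have "F ((\<lambda>q. f b q *\<^sub>R E b q) + (\<lambda>q. \<Sum>b\<in>B. f b q *\<^sub>R E b q))
        = F (\<lambda>q. f b q *\<^sub>R E b q) + F (\<lambda>q. \<Sum>b\<in>B. f b q *\<^sub>R E b q)"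
      using insert f by (intro F_add field_combination field_scale) auto
    then show ?case
      unfolding eq using insert f by (simp add: F_scale)
  qed
qed

lemma tensor_at_frame:
  fixes F :: "'m vfield \<Rightarrow> 'b::real_vector"
  assumes F: "tensor_at p F" and X [simp]: "field X"
  shows "F X = (\<Sum>b\<in>Basis. g p (X p) (E b p) *\<^sub>R F (E b))"
proof -
  let ?X = "\<lambda>q. \<Sum>b\<in>Basis. g q (X q) (E b q) *\<^sub>R E b q"
  have f: "func (\<lambda>q. g q (X q) (E b q))" if "b \<in> Basis" for b
    using that by (simp add: func_g)
  have "F ?X = F X"
    using field_combination[OF f finite_Basis] frame_expansion by (intro tensor_atD(3)[OF F]) simp_all
  then show ?thesis
    using tensor_at_combination[OF F f finite_Basis] by simp
qed

text \<open>A tensorial expression sees \<open>X\<close> only through the components of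
  \<open>X p\<close>, which the constant-coefficient extension shares.\<close>

lemma tensor_at_vf:
  fixes F :: "'m vfield \<Rightarrow> 'b::real_vector"
  assumes F: "tensor_at p F" and X [simp]: "field X"
  shows "F X = F (vf (co p (X p)))"
  using tensor_at_frame[OF F X] tensor_at_frame[OF F field_vf[of "co p (X p)"]] by (simp add: vf_co)

lemma linear_tensor_at:
  assumes F: "tensor_at p F" and T: "\<And>X. field X \<Longrightarrow> F X \<in> TM p"
  shows "linear (\<lambda>v. co p (F (vf v)))"
proof (rule linearI)
  fix v w c
  show "co p (F (vf (v + w))) = co p (F (vf v)) + co p (F (vf w))"
    by (simp add: tensor_atD(1)[OF F] vf_add co_linear T)
  show "co p (F (vf (c *\<^sub>R v))) = c *\<^sub>R co p (F (vf v))"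
    using tensor_atD(2)[OF F, of "vf v" "\<lambda>_. c"] by (simp add: vf_scale co_linear T)
qed

end

section \<open>Torsion, curvature and \<open>DT\<close> as tensors on the model space\<close>

definition tor_at :: "'m \<Rightarrow> 'e \<Rightarrow> 'e \<Rightarrow> 'e" where
  "tor_at p v w = co p (Tor (vf v) (vf w) p)"

definition curv_at :: "'m \<Rightarrow> 'e \<Rightarrow> 'e \<Rightarrow> 'e \<Rightarrow> 'e" where
  "curv_at p u v w = co p (curv A D (vf u) (vf v) (vf w) p)"

definition DT_at :: "'m \<Rightarrow> 'e \<Rightarrow> 'e \<Rightarrow> 'e \<Rightarrow> 'e" where
  "DT_at p u v w = co p (DT (vf u) (vf v) (vf w) p)"

context
  fixes p assumes p [simp]: "p \<in> W"
begin

text \<open>Arguments are replaced one slot at a time, while the other slot is held as a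
  field.\<close>

lemma co_Tor: "field X \<Longrightarrow> field Y \<Longrightarrow> co p (Tor X Y p) = tor_at p (co p (X p)) (co p (Y p))"
  using tensor_at_vf[OF p tensor_Tor(1)[of Y p], of X] tensor_at_vf[OF p tensor_Tor(2)[of "vf (co p (X p))" p], of Y]
  by (simp add: tor_at_def)

lemma co_curv: "field X \<Longrightarrow> field Y \<Longrightarrow> field Z \<Longrightarrow>
    co p (curv A D X Y Z p) = curv_at p (co p (X p)) (co p (Y p)) (co p (Z p))"
  using tensor_at_vf[OF p tensor_curv1[of Y Z p], of X] tensor_at_vf[OF p tensor_curv2[of "vf (co p (X p))" Z p], of Y]
    tensor_at_vf[OF p tensor_curv3[of "vf (co p (X p))" "vf (co p (Y p))" p], of Z]
  by (simp add: curv_at_def)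

lemma co_DT: "field X \<Longrightarrow> field Y \<Longrightarrow> field Z \<Longrightarrow>
    co p (DT X Y Z p) = DT_at p (co p (X p)) (co p (Y p)) (co p (Z p))"
  using tensor_at_vf[OF p tensor_DT1[of Y Z p], of X] tensor_at_vf[OF p tensor_DT2[of "vf (co p (X p))" Z p], of Y]
    tensor_at_vf[OF p tensor_DT3[of "vf (co p (X p))" "vf (co p (Y p))" p], of Z]
  by (simp add: DT_at_def)

lemma tor_at_bilinear: "bilinear (tor_at p)"
  unfolding bilinear_def tor_at_def
  by (intro conjI allI linear_tensor_at tensor_Tor) simp_all

lemma curv_at_linear: "linear (\<lambda>u. curv_at p u v w)" "linear (\<lambda>v. curv_at p u v w)" "linear (curv_at p u v)"
  unfolding curv_at_def by (intro linear_tensor_at tensor_curv1 tensor_curv2 tensor_curv3; simp)+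

lemma DT_at_linear: "linear (\<lambda>u. DT_at p u v w)" "linear (\<lambda>v. DT_at p u v w)" "linear (DT_at p u v)"
  unfolding DT_at_def by (intro linear_tensor_at tensor_DT1 tensor_DT2 tensor_DT3; simp)+

lemma tor_at_skew: "tor_at p w v = - tor_at p v w" "tor_at p u w \<bullet> v = - (tor_at p u v \<bullet> w)"
proof -
  show "tor_at p w v = - tor_at p v w"
    using Tor_swap[of "vf v" "vf w" p] by (simp add: tor_at_def co_linear)
  have "tor_at p u v \<bullet> w = g p (Tor (vf u) (vf v) p) (vf w p)" for u v w
    using co_inner[OF p, of "Tor (vf u) (vf v) p" "vf w p"] by (simp add: tor_at_def)
  then show "tor_at p u w \<bullet> v = - (tor_at p u v \<bullet> w)"
    using g_Tor_skew(2)[of "vf u" "vf v" "vf w" p] by simp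
qed

lemma curv_at_swap: "curv_at p v u w = - curv_at p u v w"
  using curv_swap[of "vf u" "vf w" p "vf v"] by (simp add: curv_at_def co_linear)

lemma DT_at_skew: "DT_at p u w v = - DT_at p u v w" "DT_at p u v x \<bullet> w = - (DT_at p u v w \<bullet> x)"
proof -
  show "DT_at p u w v = - DT_at p u v w"
    using DT_swap[of "vf u" "vf w" p "vf v"] by (simp add: DT_at_def co_linear)
  have "DT_at p u v w \<bullet> x = g p (DT (vf u) (vf v) (vf w) p) (vf x p)" for u v w x
    using co_inner[OF p, of "DT (vf u) (vf v) (vf w) p" "vf x p"] by (simp add: DT_at_def)
  then show "DT_at p u v x \<bullet> w = - (DT_at p u v w \<bullet> x)"
    using g_DT_skew[of "vf u" "vf v" "vf w" "vf x" p] by simp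
qed

lemma curv_at_bianchi: "curv_at p x y z + curv_at p y z x + curv_at p z x y = DT_at p x y z + DT_at p y z x + DT_at p z x y
    + tor_at p (tor_at p x y) z + tor_at p (tor_at p y z) x + tor_at p (tor_at p z x) y"
proof -
  have t: "tor_at p (tor_at p x y) z = co p (Tor (Tor (vf x) (vf y)) (vf z) p)" for x y z
    by (simp add: co_Tor)
  show ?thesis
    unfolding t curv_at_def DT_at_def using first_bianchi[of "vf x" "vf y" "vf z" p]
    by (simp flip: co_linear(1))
qed

end

end

section \<open>Connections preserving a quaternionic structure\<close>

text \<open>\<open>H\<close> is a parameter with a defining equation only to keep the simplifier from splitting \<open>L \<in> H\<close>.\<close>

locale quaternionic_torsion = framed_torsion A W D Dg g E
  for A :: "('m::{t2_space, second_countable_topology}, 'e::euclidean_space) chart set"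
    and W D Dg g E +
  fixes J1 J2 J3 :: "'m endofield" and H :: "'m endofield set"
  assumes H: "H = {J1, J2, J3}"
    and J_smooth: "L \<in> H \<Longrightarrow> smooth_endo A W L"
    and J_square: "\<lbrakk>L \<in> H; p \<in> W; x \<in> tangent_space A p\<rbrakk> \<Longrightarrow> L p (L p x) = - x"
    and J_product: "\<lbrakk>p \<in> W; x \<in> tangent_space A p\<rbrakk> \<Longrightarrow> J1 p (J2 p x) = J3 p x"
      "\<lbrakk>p \<in> W; x \<in> tangent_space A p\<rbrakk> \<Longrightarrow> J2 p (J1 p x) = - J3 p x"
    and J_orthogonal: "\<lbrakk>L \<in> H; p \<in> W; x \<in> tangent_space A p; y \<in> tangent_space A p\<rbrakk> \<Longrightarrow>
      g p (L p x) (L p y) = g p x y"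
    and D_J_span: "\<lbrakk>L \<in> H; smooth_vfield A W X; p \<in> W\<rbrakk> \<Longrightarrow>
      \<exists>a b c. \<forall>Y. smooth_vfield A W Y \<longrightarrow>
        D X (app L Y) p - L p (D X Y p) = a *\<^sub>R J1 p (Y p) + b *\<^sub>R J2 p (Y p) + c *\<^sub>R J3 p (Y p)"
    and torsion_type: "\<lbrakk>L \<in> H; smooth_vfield A W X; smooth_vfield A W Y; smooth_vfield A W Z; p \<in> W\<rbrakk> \<Longrightarrow>
      torsion3 A g D X Y Z p = torsion3 A g D (app L X) (app L Y) Z p
        + torsion3 A g D (app L X) Y (app L Z) p + torsion3 A g D X (app L Y) (app L Z) p"
begin

lemma J_mem [simp]: "J1 \<in> H" "J2 \<in> H" "J3 \<in> H"
  by (simp_all add: H)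

context
  fixes L assumes L [simp]: "L \<in> H"
begin

lemma field_app [simp]: "field X \<Longrightarrow> field (app L X)"
  using J_smooth[OF L] open_W unfolding smooth_endo_def app_def by blast

context
  fixes p assumes p [simp]: "p \<in> W"
begin

lemma J_tangent: "tangent_endo A p (L p)"
  using J_smooth[OF L] unfolding smooth_endo_def by simp

lemma J_TM [simp]: "x \<in> TM p \<Longrightarrow> L p x \<in> TM p"
  and J_add: "x \<in> TM p \<Longrightarrow> y \<in> TM p \<Longrightarrow> L p (x + y) = L p x + L p y"
  and J_scale: "x \<in> TM p \<Longrightarrow> L p (c *\<^sub>R x) = c *\<^sub>R L p x"
  using J_tangent unfolding tangent_endo_def by blast+

lemma J_minus: "x \<in> TM p \<Longrightarrow> L p (- x) = - L p x"
  using J_scale[of x "-1"] by simp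

lemma J_diff: "x \<in> TM p \<Longrightarrow> y \<in> TM p \<Longrightarrow> L p (x - y) = L p x - L p y"
  using J_add[of x "- y"] by (simp add: J_minus)

end

end

lemma app_apply: "app L X p = L p (X p)"
  by (simp add: app_def)

definition J_at :: "'m endofield \<Rightarrow> 'm \<Rightarrow> 'e \<Rightarrow> 'e" where
  "J_at L p v = co p (L p (vf v p))"

lemma co_J: "L \<in> H \<Longrightarrow> p \<in> W \<Longrightarrow> x \<in> TM p \<Longrightarrow> co p (L p x) = J_at L p (co p x)"
  by (simp add: J_at_def vf_co)

lemma vf_J_at: "L \<in> H \<Longrightarrow> p \<in> W \<Longrightarrow> vf (J_at L p v) p = L p (vf v p)"
  by (simp add: J_at_def vf_co)

lemma J_at_complex_structure:
  assumes L [simp]: "L \<in> H" and p [simp]: "p \<in> W"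
  shows "complex_structure (J_at L p)"
proof (rule complex_structure.intro)
  have "vf (v + w) p = vf v p + vf w p" for v w
    by (simp add: vf_add)
  then show "linear (J_at L p)"
    by (intro linearI) (simp_all add: J_at_def vf_scale J_add J_scale co_linear del: plus_fun_apply)
  have x: "vf x p \<in> TM p" for x
    by simp
  show "J_at L p (J_at L p x) = - x" for x
    unfolding J_at_def[of L p "J_at L p x"] vf_J_at[OF L p] J_square[OF L p x] co_linear(3)[OF p x] co_vf[OF p] ..
  show "J_at L p x \<bullet> J_at L p y = x \<bullet> y" for x y
    using co_inner[OF p, of "vf x p" "vf y p"] by (simp add: J_at_def co_inner J_orthogonal)
qed

lemma J_at_quaternionic_structure:
  assumes p [simp]: "p \<in> W"
  shows "quaternionic_structure (J_at J1 p) (J_at J2 p) (J_at J3 p)"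
proof -
  have "J_at J1 p (J_at J2 p x) = J_at J3 p x" "J_at J2 p (J_at J1 p x) = - J_at J3 p x" for x
    unfolding J_at_def[of J1 p "J_at J2 p x"] J_at_def[of J2 p "J_at J1 p x"]
    by (simp_all add: vf_J_at J_product co_linear J_at_def[of J3])
  then show ?thesis
    by (simp add: quaternionic_structure_def quaternionic_structure_axioms_def J_at_complex_structure)
qed

lemma Tor_inner:
  "\<lbrakk>p \<in> W; field X; field Y; field Z\<rbrakk> \<Longrightarrow>
    torsion3 A g D X Y Z p = tor_at p (co p (X p)) (co p (Y p)) \<bullet> co p (Z p)"
  using co_inner[of p "Tor X Y p" "Z p"] by (simp add: torsion3_def co_Tor)

lemma tor_at_type:
  assumes L [simp]: "L \<in> H" and p [simp]: "p \<in> W"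
  shows "tor_at p x y \<bullet> z = tor_at p (J_at L p x) (J_at L p y) \<bullet> z + tor_at p (J_at L p x) y \<bullet> J_at L p z
    + tor_at p x (J_at L p y) \<bullet> J_at L p z"
  using torsion_type[OF L, of "vf x" "vf y" "vf z" p] by (simp add: Tor_inner app_apply co_J)

lemma torsion_algebra_at:
  assumes p [simp]: "p \<in> W"
  shows "torsion_algebra (J_at J1 p) (J_at J2 p) (J_at J3 p) (tor_at p)"
  unfolding torsion_algebra_def torsion_algebra_axioms_def
  by (intro conjI allI J_at_quaternionic_structure tor_at_bilinear tor_at_skew tor_at_type) simp_all

text \<open>Component of the derivative of \<open>L\<close> along \<open>M\<close>. By
  \<open>trace_product\<close> each of \<open>J1\<close>, \<open>J2\<close>, \<open>J3\<close> has
  squared length \<open>DIM('e)\<close> in the trace form, which explains the normalisation.\<close>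

definition conn_form :: "'m endofield \<Rightarrow> 'm endofield \<Rightarrow> 'm vfield \<Rightarrow> 'm \<Rightarrow> real" where
  "conn_form L M X q = (\<Sum>b\<in>Basis. g q (D X (app L (E b)) q - L q (D X (E b) q)) (M q (E b q))) * (1 / DIM('e))"

lemma func_conn_form:
  assumes [simp]: "L \<in> H" "M \<in> H" "field X"
  shows "func (conn_form L M X)"
proof -
  have "func (\<lambda>q. g q ((D X (app L (E b)) - app L (D X (E b))) q) (app M (E b) q))" if [simp]: "b \<in> Basis" for b
    by (rule func_g) (simp_all del: minus_apply)
  then show ?thesis
    unfolding conn_form_def[abs_def] by (intro func_mult func_sum) (simp_all add: app_apply)
qed

text \<open>Tracing the pointwise relation of \<open>D_J_span\<close> against each endomorphism
  identifies its coefficients with values of \<open>conn_form\<close>.\<close>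

lemma D_J:
  assumes L [simp]: "L \<in> H" and X [simp]: "field X" and Y [simp]: "field Y" and q [simp]: "q \<in> W"
  shows "D X (app L Y) q = L q (D X Y q) + (conn_form L J1 X q *\<^sub>R J1 q (Y q) + conn_form L J2 X q *\<^sub>R J2 q (Y q)
    + conn_form L J3 X q *\<^sub>R J3 q (Y q))"
proof -
  obtain a b c where abc: "\<And>Y. field Y \<Longrightarrow>
      D X (app L Y) q - L q (D X Y q) = a *\<^sub>R J1 q (Y q) + b *\<^sub>R J2 q (Y q) + c *\<^sub>R J3 q (Y q)"
    using D_J_span[OF L X q] by blast
  interpret q1: quaternionic_structure "J_at J1 q" "J_at J2 q" "J_at J3 q"
    by (rule J_at_quaternionic_structure[OF q])
  interpret q2: quaternionic_structure "J_at J2 q" "J_at J3 q" "J_at J1 q"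
    by (rule q1.cyclic)
  interpret q3: quaternionic_structure "J_at J3 q" "J_at J1 q" "J_at J2 q"
    by (rule q2.cyclic)
  have *: "conn_form L M X q = (a * (\<Sum>b\<in>Basis. J_at J1 q b \<bullet> J_at M q b) + b * (\<Sum>b\<in>Basis. J_at J2 q b \<bullet> J_at M q b)
      + c * (\<Sum>b\<in>Basis. J_at J3 q b \<bullet> J_at M q b)) * (1 / DIM('e))" if [simp]: "M \<in> H" for M
  proof -
    have "g q (M' q (E b q)) (M q (E b q)) = J_at M' q b \<bullet> J_at M q b"
      if [simp]: "b \<in> Basis" "M' \<in> H" for b M'
      using co_inner[OF q, of "M' q (E b q)" "M q (E b q)"] by (simp add: co_J)
    then show ?thesis
      unfolding conn_form_def by (simp add: abc g_simps sum.distrib sum_distrib_left)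
  qed
  have "conn_form L J1 X q = a" "conn_form L J2 X q = b" "conn_form L J3 X q = c"
    by (simp_all add: * q1.trace_product q2.trace_product q3.trace_product del: q1.I.orthogonal q1.J.orthogonal q1.K.orthogonal)
  then show ?thesis
    using abc[OF Y] by (simp add: algebra_simps)
qed

text \<open>Differentiating \<open>D_J\<close> again gives terms of first order in \<open>Z\<close>
  that are symmetric in \<open>X\<close> and \<open>Y\<close> and so drop out of the commutator.
  What remains is the curvature of the connection induced on the bundle, acting on
  \<open>L\<close>.\<close>

lemma curv_J:
  assumes L [simp]: "L \<in> H" and X [simp]: "field X" and Y [simp]: "field Y" and p [simp]: "p \<in> W"
  shows "\<exists>a b c. \<forall>Z. field Z \<longrightarrow> curv A D X Y (app L Z) p - L p (curv A D X Y Z p)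
    = a *\<^sub>R J1 p (Z p) + b *\<^sub>R J2 p (Z p) + c *\<^sub>R J3 p (Z p)"
proof -
  \<comment> \<open>Coefficient of \<open>N\<close> in the zeroth-order part: the derivative of a
    connection form, plus products of two connection forms that arise from differentiating
    \<open>J1\<close>, \<open>J2\<close>, \<open>J3\<close>.\<close>
  define k where "k X Y N = X p (conn_form L N Y) + conn_form L J1 Y p * conn_form J1 N X p + conn_form L J2 Y p * conn_form J2 N X p
    + conn_form L J3 Y p * conn_form J3 N X p" for X Y N
  have second_derivative: "D X (D Y (app L Z)) p = L p (D X (D Y Z) p)
      + (conn_form L J1 X p *\<^sub>R J1 p (D Y Z p) + conn_form L J2 X p *\<^sub>R J2 p (D Y Z p) + conn_form L J3 X p *\<^sub>R J3 p (D Y Z p))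
      + (conn_form L J1 Y p *\<^sub>R J1 p (D X Z p) + conn_form L J2 Y p *\<^sub>R J2 p (D X Z p) + conn_form L J3 Y p *\<^sub>R J3 p (D X Z p))
      + (k X Y J1 *\<^sub>R J1 p (Z p) + k X Y J2 *\<^sub>R J2 p (Z p) + k X Y J3 *\<^sub>R J3 p (Z p))"
    if [simp]: "field X" "field Y" "field Z" for X Y Z
  proof -
    let ?o = "\<lambda>M. (\<lambda>q. conn_form L M Y q *\<^sub>R app M Z q)"
    have f [simp]: "func (conn_form L J1 Y)" "func (conn_form L J2 Y)" "func (conn_form L J3 Y)"
      by (simp_all add: func_conn_form)
    have [simp]: "field (?o J1)" "field (?o J2)" "field (?o J3)"
      by (simp_all add: field_scale)
    have e: "D Y (app L Z) q = (app L (D Y Z) + (?o J1 + ?o J2 + ?o J3)) q" if "q \<in> W" for q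
      using that by (simp add: D_J app_apply)
    have "D X (D Y (app L Z)) p = D X (app L (D Y Z) + (?o J1 + ?o J2 + ?o J3)) p"
      by (rule D_cong) (simp_all del: plus_fun_apply add: e)
    also have "\<dots> = D X (app L (D Y Z)) p + (D X (?o J1) p + D X (?o J2) p + D X (?o J3) p)"
      by (simp add: D_add)
    also have "\<dots> = L p (D X (D Y Z) p)
      + (conn_form L J1 X p *\<^sub>R J1 p (D Y Z p) + conn_form L J2 X p *\<^sub>R J2 p (D Y Z p) + conn_form L J3 X p *\<^sub>R J3 p (D Y Z p))
      + ((X p (conn_form L J1 Y) *\<^sub>R app J1 Z p + conn_form L J1 Y p *\<^sub>R D X (app J1 Z) p)
      + (X p (conn_form L J2 Y) *\<^sub>R app J2 Z p + conn_form L J2 Y p *\<^sub>R D X (app J2 Z) p)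
      + (X p (conn_form L J3 Y) *\<^sub>R app J3 Z p + conn_form L J3 Y p *\<^sub>R D X (app J3 Z) p))"
      unfolding D_scale(2)[OF that(1) field_app[OF J_mem(1) that(3)] p f(1)]
        D_scale(2)[OF that(1) field_app[OF J_mem(2) that(3)] p f(2)]
        D_scale(2)[OF that(1) field_app[OF J_mem(3) that(3)] p f(3)]
      by (simp add: D_J)
    finally show ?thesis
      by (simp add: D_J app_apply k_def algebra_simps)
  qed
  have cv: "curv A D X Y V p = D X (D Y V) p - D Y (D X V) p - D (br X Y) V p" for V
    by (simp add: curv_def)
  have "curv A D X Y (app L Z) p - L p (curv A D X Y Z p)
    = (k X Y J1 - k Y X J1 - conn_form L J1 (br X Y) p) *\<^sub>R J1 p (Z p)
    + (k X Y J2 - k Y X J2 - conn_form L J2 (br X Y) p) *\<^sub>R J2 p (Z p)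
    + (k X Y J3 - k Y X J3 - conn_form L J3 (br X Y) p) *\<^sub>R J3 p (Z p)" if [simp]: "field Z" for Z
    unfolding cv second_derivative[OF X Y that] second_derivative[OF Y X that] D_J[OF L field_br[OF X Y] that p]
    by (simp add: J_diff J_add algebra_simps del: minus_apply plus_fun_apply)
  then show ?thesis
    by blast
qed

lemma curv_at_J:
  assumes L [simp]: "L \<in> H" and p [simp]: "p \<in> W"
  shows "\<exists>a b c. \<forall>z. curv_at p x y (J_at L p z) - J_at L p (curv_at p x y z)
    = a *\<^sub>R J_at J1 p z + b *\<^sub>R J_at J2 p z + c *\<^sub>R J_at J3 p z"
proof -
  obtain a b c where abc: "\<And>Z. field Z \<Longrightarrow> curv A D (vf x) (vf y) (app L Z) p - L p (curv A D (vf x) (vf y) Z p)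
      = a *\<^sub>R J1 p (Z p) + b *\<^sub>R J2 p (Z p) + c *\<^sub>R J3 p (Z p)"
    using curv_J[OF L field_vf[of x] field_vf[of y] p] by blast
  have "curv_at p x y (J_at L p z) - J_at L p (curv_at p x y z)
    = a *\<^sub>R J_at J1 p z + b *\<^sub>R J_at J2 p z + c *\<^sub>R J_at J3 p z" for z
  proof -
    have "co p (curv A D (vf x) (vf y) (app L (vf z)) p - L p (curv A D (vf x) (vf y) (vf z) p))
        = curv_at p x y (J_at L p z) - J_at L p (curv_at p x y z)"
      by (simp add: co_linear co_curv co_J app_apply)
    then show ?thesis
      unfolding abc[OF field_vf] by (simp add: co_linear co_J)
  qed
  then show ?thesis by blast
qed

text \<open>Differentiating the square of \<open>L\<close> shows that \<open>L\<close> anticommutes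
  with its derivative. The components along the other two endomorphisms anticommute with
  \<open>L\<close> in any case, and the one along \<open>L\<close> contributes - 2 times
  itself.\<close>

lemma conn_form_diag:
  assumes L [simp]: "L \<in> H" and X [simp]: "field X" and p [simp]: "p \<in> W"
  shows "conn_form L L X p = 0"
proof -
  obtain b :: 'e where b [simp]: "b \<in> Basis" using nonempty_Basis by blast
  interpret q: quaternionic_structure "J_at J1 p" "J_at J2 p" "J_at J3 p"
    by (rule J_at_quaternionic_structure[OF p])
  have sq: "app L (app L (E b)) q = (- E b) q" if q: "q \<in> W" for q
    using J_square[OF L q, of "E b q"] q by (simp add: app_apply fun_Compl_def)
  have "D X (app L (app L (E b))) p = D X (- E b) p"
    by (rule D_cong[OF X field_minus[OF E_field[OF b]] refl sq p])
  then have "L p (conn_form L J1 X p *\<^sub>R J1 p (E b p) + conn_form L J2 X p *\<^sub>R J2 p (E b p) + conn_form L J3 X p *\<^sub>R J3 p (E b p))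
     + (conn_form L J1 X p *\<^sub>R J1 p (L p (E b p)) + conn_form L J2 X p *\<^sub>R J2 p (L p (E b p)) + conn_form L J3 X p *\<^sub>R J3 p (L p (E b p))) = 0"
    unfolding D_J[OF L X field_app[OF L E_field[OF b]] p] D_J[OF L X E_field[OF b] p] app_apply
      D_minus(2)[OF X E_field[OF b] p]
    by (simp add: J_add J_square add.assoc del: plus_fun_apply minus_apply uminus_apply)
  then have "co p (L p (conn_form L J1 X p *\<^sub>R J1 p (E b p) + conn_form L J2 X p *\<^sub>R J2 p (E b p) + conn_form L J3 X p *\<^sub>R J3 p (E b p))
     + (conn_form L J1 X p *\<^sub>R J1 p (L p (E b p)) + conn_form L J2 X p *\<^sub>R J2 p (L p (E b p)) + conn_form L J3 X p *\<^sub>R J3 p (L p (E b p)))) = 0"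
    by (simp add: co_def g_zero)
  then have "J_at L p (conn_form L J1 X p *\<^sub>R J_at J1 p b + conn_form L J2 X p *\<^sub>R J_at J2 p b + conn_form L J3 X p *\<^sub>R J_at J3 p b)
     + (conn_form L J1 X p *\<^sub>R J_at J1 p (J_at L p b) + conn_form L J2 X p *\<^sub>R J_at J2 p (J_at L p b) + conn_form L J3 X p *\<^sub>R J_at J3 p (J_at L p b)) = 0"
    by (simp add: co_linear co_J)
  moreover have "L = J1 \<or> L = J2 \<or> L = J3"
    using L by (simp add: H)
  ultimately have "(-2 * conn_form L L X p) *\<^sub>R b = 0"
    by (elim disjE) (simp_all add: algebra_simps flip: scaleR_2)
  moreover have "b \<noteq> 0"
    using nonzero_Basis[OF b] .
  ultimately show ?thesis by simp
qed

section \<open>The torsion 1-form and its divergence\<close>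

definition tau :: "'m endofield \<Rightarrow> 'm vfield \<Rightarrow> 'm \<Rightarrow> real" where
  "tau L X = (\<lambda>q. 1/2 * (\<Sum>b\<in>Basis. torsion3 A g D (app L X) (E b) (app L (E b)) q))"

lemma tau_eq:
  assumes L [simp]: "L \<in> H" and X [simp]: "field X" and q [simp]: "q \<in> W"
  shows "tau L X q = 1/2 * (\<Sum>b\<in>Basis. tor_at q (J_at L q (co q (X q))) b \<bullet> J_at L q b)"
  by (simp add: tau_def Tor_inner app_apply co_J)

lemma func_tau: "L \<in> H \<Longrightarrow> field X \<Longrightarrow> func (tau L X)"
  unfolding tau_def torsion3_def by (intro func_mult func_sum func_g smooth_fun_const) simp_all

lemma tau_independent:
  assumes L [simp]: "L \<in> H" and M [simp]: "M \<in> H" and X [simp]: "field X" and q [simp]: "q \<in> W"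
  shows "tau L X q = tau M X q"
proof -
  interpret t: torsion_algebra "J_at J1 q" "J_at J2 q" "J_at J3 q" "tor_at q"
    by (rule torsion_algebra_at[OF q])
  have *: "tau L X q = 1/2 * t.trace1 (J_at L q) (J_at L q (co q (X q)))" if "L \<in> H" for L
    using tau_eq[OF that X q] by (simp add: t.trace1_def)
  have "tau J1 X q = tau J2 X q" "tau J3 X q = tau J2 X q"
    using t.trace1_I[of "co q (X q)"] by (simp_all add: *)
  then show ?thesis
    using L M unfolding H by auto
qed

lemma tangent_apply_sum:
  assumes "x \<in> TM p" "p \<in> W" "\<And>b. b \<in> B \<Longrightarrow> func (f b)"
  shows "x (\<lambda>q. \<Sum>b\<in>B. f b q) = (\<Sum>b\<in>B. x (f b))"
  using assms(3)
proof (induction B rule: infinite_finite_induct)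
  case (insert b B)
  have "x (\<lambda>q. f b q + (\<Sum>b\<in>B. f b q)) = x (f b) + x (\<lambda>q. \<Sum>b\<in>B. f b q)"
    using insert by (intro tangent_apply_add[OF assms(1) open_W assms(2)] func_sum) auto
  then show ?case
    using insert by simp
qed (simp_all add: tangent_apply_const[OF assms(1) open_W assms(2)])

text \<open>Differentiating the trace produces two corrections, \<open>G\<close> from the frame and
  \<open>S\<close> from the endomorphism. The first vanishes by \<open>trace_parallel\<close>, the
  second by \<open>trace1_mixed\<close> together with \<open>conn_form_diag\<close>.\<close>

lemma tau_derivative:
  assumes L [simp]: "L \<in> H" and X [simp]: "field X" and Y [simp]: "field Y" and p [simp]: "p \<in> W"
  shows "X p (tau L Y) - tau L (D X Y) p
    = 1/2 * (\<Sum>b\<in>Basis. DT_at p (co p (X p)) (J_at L p (co p (Y p))) b \<bullet> J_at L p b)"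
proof -
  interpret t1: torsion_algebra "J_at J1 p" "J_at J2 p" "J_at J3 p" "tor_at p"
    by (rule torsion_algebra_at[OF p])
  interpret t2: torsion_algebra "J_at J2 p" "J_at J3 p" "J_at J1 p" "tor_at p"
    by (rule t1.cyclic_torsion)
  interpret t3: torsion_algebra "J_at J3 p" "J_at J1 p" "J_at J2 p" "tor_at p"
    by (rule t2.cyclic_torsion)
  define G where "G v = co p (D X (vf v) p)" for v
  define S where "S v = conn_form L J1 X p *\<^sub>R J_at J1 p v + conn_form L J2 X p *\<^sub>R J_at J2 p v + conn_form L J3 X p *\<^sub>R J_at J3 p v" for v
  let ?L = "J_at L p"
  let ?y = "co p (Y p)"
  have L_cases: "L = J1 \<or> L = J2 \<or> L = J3"
    using L by (simp add: H)
  have "linear G"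
    by (rule linearI) (simp_all add: G_def vf_add vf_scale D_add D_scale co_linear)
  moreover have "G v \<bullet> w = - (v \<bullet> G w)" for v w
  proof -
    \<comment> \<open>Constant coefficients in an orthonormal frame make this inner product constant
      on \<open>W\<close>, and its vanishing derivative is the skewness of \<open>G\<close>.\<close>
    have "X p (\<lambda>q. g q (vf v q) (vf w q)) = X p (\<lambda>q. v \<bullet> w)"
      by (rule tangent_apply_cong[OF field_TM[of X p] open_W, where h = "\<lambda>_. 0"])
        (simp_all add: func_g flip: co_inner)
    then have "g p (D X (vf v) p) (vf w p) + g p (vf v p) (D X (vf w) p) = 0"
      using D_metric(1)[of X "vf v" "vf w" p] by (simp add: apply_const)
    then show ?thesis
      by (simp add: G_def flip: co_inner)
  qed
  ultimately have par: "(\<Sum>b\<in>Basis. tor_at p v (G b) \<bullet> ?L b + tor_at p v b \<bullet> ?L (G b)) = 0" for v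
    using L_cases t1.trace_parallel[of G v] t2.trace_parallel[of G v] t3.trace_parallel[of G v] by auto
  have "(\<Sum>b\<in>Basis. tor_at p (S ?y) b \<bullet> ?L b + tor_at p (?L ?y) b \<bullet> S b)
      = conn_form L J1 X p * (t1.trace1 ?L (J_at J1 p ?y) + t1.trace1 (J_at J1 p) (?L ?y))
      + conn_form L J2 X p * (t1.trace1 ?L (J_at J2 p ?y) + t1.trace1 (J_at J2 p) (?L ?y))
      + conn_form L J3 X p * (t1.trace1 ?L (J_at J3 p ?y) + t1.trace1 (J_at J3 p) (?L ?y))"
    by (simp add: S_def t1.trace1_def inner_simps sum.distrib sum_distrib_left distrib_left)
  also have "\<dots> = 0"
    using L_cases conn_form_diag[OF L X p] t1.trace1_mixed[of ?y] t2.trace1_mixed[of ?y] t3.trace1_mixed[of ?y]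
    by (elim disjE) (simp_all add: add.commute)
  finally have skew: "(\<Sum>b\<in>Basis. tor_at p (S ?y) b \<bullet> ?L b + tor_at p (?L ?y) b \<bullet> S b) = 0" .
  have h: "X p (\<lambda>q. torsion3 A g D (app L Y) (E b) (app L (E b)) q)
    = DT_at p (co p (X p)) (?L ?y) b \<bullet> ?L b + tor_at p (?L (co p (D X Y p))) b \<bullet> ?L b
      + (tor_at p (S ?y) b \<bullet> ?L b + tor_at p (?L ?y) b \<bullet> S b)
      + (tor_at p (?L ?y) (G b) \<bullet> ?L b + tor_at p (?L ?y) b \<bullet> ?L (G b))" if b [simp]: "b \<in> Basis" for b
  proof -
    have "D X (Tor (app L Y) (E b)) p = DT X (app L Y) (E b) p + Tor (D X (app L Y)) (E b) p
        + Tor (app L Y) (D X (E b)) p"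
      by (simp add: DT_def)
    moreover have "co p (D X (app L Y) p) = ?L (co p (D X Y p)) + S ?y" "co p (D X (app L (E b)) p) = ?L (G b) + S b"
      by (simp_all add: D_J co_linear co_J S_def G_def vf_Basis)
    moreover have "co p (D X (E b) p) = G b"
      by (simp add: G_def vf_Basis)
    ultimately have "g p (D X (Tor (app L Y) (E b)) p) (app L (E b) p)
          + g p (Tor (app L Y) (E b) p) (D X (app L (E b)) p)
        = (DT_at p (co p (X p)) (?L ?y) b + tor_at p (?L (co p (D X Y p)) + S ?y) b + tor_at p (?L ?y) (G b)) \<bullet> ?L b
          + tor_at p (?L ?y) b \<bullet> (?L (G b) + S b)"
      by (simp add: co_linear co_DT co_Tor co_J app_apply flip: co_inner)
    then show ?thesis
      unfolding torsion3_def using D_metric(1)[of X "Tor (app L Y) (E b)" "app L (E b)" p]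
      by (simp add: inner_simps)
  qed
  have "X p (tau L Y) = 1/2 * (\<Sum>b\<in>Basis. X p (\<lambda>q. torsion3 A g D (app L Y) (E b) (app L (E b)) q))"
  proof -
    have f: "func (\<lambda>q. torsion3 A g D (app L Y) (E b) (app L (E b)) q)" if "b \<in> Basis" for b
      unfolding torsion3_def using that by (intro func_g) simp_all
    have "X p (tau L Y) = 1/2 * X p (\<lambda>q. \<Sum>b\<in>Basis. torsion3 A g D (app L Y) (E b) (app L (E b)) q)"
      unfolding tau_def using f
      by (intro tangent_apply_scale[OF field_TM[OF X p] open_W p _ smooth_fun_const] func_sum) auto
    also have "X p (\<lambda>q. \<Sum>b\<in>Basis. torsion3 A g D (app L Y) (E b) (app L (E b)) q)
        = (\<Sum>b\<in>Basis. X p (\<lambda>q. torsion3 A g D (app L Y) (E b) (app L (E b)) q))"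
      using f by (rule tangent_apply_sum[OF field_TM[OF X p] p])
    finally show ?thesis .
  qed
  also have "\<dots> = 1/2 * (\<Sum>b\<in>Basis. DT_at p (co p (X p)) (?L ?y) b \<bullet> ?L b) + tau L (D X Y) p"
    using par[of "?L ?y"] skew by (simp add: h sum.distrib tau_eq)
  finally show ?thesis
    by simp
qed

text \<open>This is \<open>- \<delta>t\<close>.\<close>

definition divergence :: "'m endofield \<Rightarrow> 'm \<Rightarrow> real" where
  "divergence L p = (\<Sum>a\<in>Basis. E a p (tau L (E a)) - tau L (Dg (E a) (E a)) p)"

text \<open>The torsion vanishes on equal arguments, so \<open>Dg\<close> may be replaced by
  \<open>D\<close> on the diagonal and \<open>tau_derivative\<close> applies; the factor 2 undoes
  the 1/2 in \<open>tau\<close>.\<close>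

lemma divergence_eq:
  assumes L [simp]: "L \<in> H" and p [simp]: "p \<in> W"
  shows "(\<Sum>a\<in>Basis. \<Sum>b\<in>Basis. DT_at p a (J_at L p a) b \<bullet> J_at L p b) = 2 * divergence L p"
proof -
  have "Dg (E a) (E a) p = D (E a) (E a) p" if [simp]: "a \<in> Basis" for a
    using Dg_eq[of "E a" "E a" p] Tor_eq[of "E a" "E a" p] by simp
  then have "tau L (Dg (E a) (E a)) p = tau L (D (E a) (E a)) p" if [simp]: "a \<in> Basis" for a
    by (simp add: tau_eq)
  then have "divergence L p = (\<Sum>a\<in>Basis. 1/2 * (\<Sum>b\<in>Basis. DT_at p a (J_at L p a) b \<bullet> J_at L p b))"
    unfolding divergence_def using tau_derivative[OF L, of "E a" "E a" p for a] by (intro sum.cong refl) simp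
  then show ?thesis
    unfolding sum_distrib_left[symmetric] by simp
qed

lemma divergence_independent:
  assumes L [simp]: "L \<in> H" and M [simp]: "M \<in> H" and p [simp]: "p \<in> W"
  shows "divergence L p = divergence M p"
  unfolding divergence_def
proof (intro sum.cong refl arg_cong2[of _ _ _ _ minus])
  fix a :: 'e assume a [simp]: "a \<in> Basis"
  show "E a p (tau L (E a)) = E a p (tau M (E a))"
    by (rule tangent_apply_cong[OF field_TM open_W, where h = "\<lambda>_. 0"])
      (simp_all add: func_tau tau_independent[of L M])
  show "tau L (Dg (E a) (E a)) p = tau M (Dg (E a) (E a)) p"
    by (simp add: tau_independent[of L M])
qed

lemma curvature_algebra_at:
  assumes L [simp]: "L \<in> H" and p [simp]: "p \<in> W"
  shows "curvature_algebra (J_at J1 p) (J_at J2 p) (J_at J3 p) (tor_at p) (curv_at p) (DT_at p) (divergence L p)"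
proof -
  have "(\<Sum>a\<in>Basis. \<Sum>b\<in>Basis. DT_at p a (J_at M p a) b \<bullet> J_at M p b) = 2 * divergence L p" if "M \<in> H" for M
    unfolding divergence_independent[OF L that p] by (rule divergence_eq[OF that p])
  then show ?thesis
    unfolding curvature_algebra_def curvature_algebra_axioms_def
    by (intro conjI allI torsion_algebra_at curv_at_linear DT_at_linear curv_at_swap DT_at_skew curv_at_J curv_at_bianchi) simp_all
qed

end

section \<open>Return from the model space to the manifold\<close>

context quaternionic_torsion begin

lemma curv4_eq:
  "\<lbrakk>p \<in> W; field X; field Y; field Z; field V\<rbrakk> \<Longrightarrow>
    curv4 A g D X Y Z V p = curv_at p (co p (X p)) (co p (Y p)) (co p (Z p)) \<bullet> co p (V p)"
  by (simp add: curv4_def co_curv flip: co_inner)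

text \<open>Separate endomorphisms serve the torsion 1-form and the two quaternionic scalar
  curvatures, so that independence of these choices is part of the conclusion.\<close>

lemma scalar_relations:
  assumes n: "DIM('e) = 4 * n" "n > 1"
    and L [simp]: "L \<in> H" and M [simp]: "M \<in> H" and M' [simp]: "M' \<in> H" and p [simp]: "p \<in> W"
  defines "ScalQ \<equiv> - (\<Sum>a\<in>Basis. 1/2 * (\<Sum>b\<in>Basis. curv4 A g D (E a) (app M (E a)) (E b) (app M (E b)) p))"
    and "ScalgQ \<equiv> - (\<Sum>a\<in>Basis. 1/2 * (\<Sum>b\<in>Basis. curv4 A g Dg (E a) (app M' (E a)) (E b) (app M' (E b)) p))"
    and "Scal \<equiv> \<Sum>a\<in>Basis. \<Sum>b\<in>Basis. curv4 A g D (E b) (E a) (E a) (E b) p"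
    and "Scalg \<equiv> \<Sum>a\<in>Basis. \<Sum>b\<in>Basis. curv4 A g Dg (E b) (E a) (E a) (E b) p"
    and "nt \<equiv> \<Sum>a\<in>Basis. (tau L (E a) p)\<^sup>2"
    and "nT \<equiv> \<Sum>a\<in>Basis. \<Sum>b\<in>Basis. \<Sum>c\<in>Basis. (torsion3 A g D (E a) (E b) (E c) p)\<^sup>2"
  shows "Scalg = (real n + 2) / real n * ScalQ + 3 * divergence L p + 2 * nt - 1/12 * nT"
    "ScalgQ = ScalQ + divergence L p + nt - 1/12 * nT"
    "Scal = (real n + 2) / real n * ScalQ + 3 * divergence L p + 2 * nt - 1/3 * nT"
proof -
  interpret c: curvature_algebra "J_at J1 p" "J_at J2 p" "J_at J3 p" "tor_at p" "curv_at p" "DT_at p" "divergence L p"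
    by (rule curvature_algebra_at[OF L p])
  have LC_eq: "curv4 A g Dg X Y Z V p = c.LC (co p (X p)) (co p (Y p)) (co p (Z p)) \<bullet> co p (V p)"
    if [simp]: "field X" "field Y" "field Z" "field V" for X Y Z V
  proof -
    have "co p (curv A Dg X Y Z p) = c.LC (co p (X p)) (co p (Y p)) (co p (Z p))"
      by (simp add: curv_Dg c.LC_def co_linear co_curv co_DT co_Tor)
    then show ?thesis
      by (simp add: curv4_def flip: co_inner)
  qed
  have "ScalQ = c.scalar_Q (J_at M p)"
    unfolding ScalQ_def c.scalar_Q_def c.rho_def by (simp add: curv4_eq app_apply co_J)
  also have "\<dots> = c.scalar_Q (J_at J1 p)"
    using M c.scalar_curvatures(1,2)[OF n] unfolding H by auto
  finally have Q: "ScalQ = c.scalar_Q (J_at J1 p)" .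
  have "ScalgQ = - 1/2 * (\<Sum>a\<in>Basis. \<Sum>b\<in>Basis. c.LC a (J_at M' p a) b \<bullet> J_at M' p b)"
    unfolding ScalgQ_def sum_distrib_left[symmetric] by (simp add: LC_eq app_apply co_J)
  then have gQ: "ScalgQ = c.scalar_Q (J_at J1 p) + divergence L p + c.norm2_t - c.norm2_T / 12"
    using M' c.scalar_Q_LC c.scalar_Q_LC_cyclic c.scalar_curvatures(1,2)[OF n] unfolding H by auto
  have S: "Scal = c.scalar"
    unfolding Scal_def c.scalar_def by (simp add: curv4_eq)
  have gS: "Scalg = c.scalar + c.norm2_T / 4"
    unfolding Scalg_def c.scalar_LC[symmetric] by (simp add: LC_eq)
  have T: "nT = c.norm2_T"
    unfolding nT_def c.norm2_T_def by (simp add: Tor_inner)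
  have tau: "tau L (E a) p = 1/2 * c.trace1 (J_at J1 p) (J_at J1 p a)" if [simp]: "a \<in> Basis" for a
    using tau_independent[OF L J_mem(1), of "E a" p] tau_eq[OF J_mem(1), of "E a" p]
    by (simp add: c.trace1_def)
  have t: "nt = c.norm2_t"
    unfolding nt_def c.norm2_t_def sum_distrib_left by (intro sum.cong refl) (simp add: tau power2_eq_square)
  show "Scalg = (real n + 2) / real n * ScalQ + 3 * divergence L p + 2 * nt - 1/12 * nT"
    "ScalgQ = ScalQ + divergence L p + nt - 1/12 * nT"
    "Scal = (real n + 2) / real n * ScalQ + 3 * divergence L p + 2 * nt - 1/3 * nT"
    unfolding gS gQ S Q T t c.scalar_curvatures(3)[OF n] by simp_all
qed

end

text \<open>Passage from the global definitions to the data over one \<open>W\<close>. The metric is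
  hermitian for each \<open>J \<alpha>\<close> because \<open>J \<alpha>\<close> lies in
  \<open>Q\<close> and squares to minus the identity.\<close>

lemma QKT_quaternionic_torsion:
  fixes A :: "('m::{t2_space, second_countable_topology}, 'e::euclidean_space) chart set"
  assumes M: "QKT_manifold A g Q" and D: "QKT_connection A g Q D" and Dg: "levi_civita A g Dg"
    and W: "open W" and J: "admissible_basis A Q W J"
    and E: "\<And>b. b \<in> Basis \<Longrightarrow> smooth_vfield A W (E b)"
      "\<And>p b c. \<lbrakk>p \<in> W; b \<in> Basis; c \<in> Basis\<rbrakk> \<Longrightarrow> g p (E b p) (E c p) = (if b = c then 1 else 0)"
  shows "quaternionic_torsion A W D Dg g (E :: 'e \<Rightarrow> 'm vfield) (J 1) (J 2) (J 3) {J 1, J 2, J 3}"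
proof -
  note M' = M[unfolded QKT_manifold_def]
  note D' = D[unfolded QKT_connection_def]
  note J' = J[unfolded admissible_basis_def]
  have Jmem: "\<exists>\<alpha>\<in>{1, 2, 3}. L = J \<alpha>" if "L \<in> {J 1, J 2, J 3}" for L
    using that by blast
  have LQ: "L p \<in> Q p" if "L \<in> {J 1, J 2, J 3}" "p \<in> W" for L p
    using that J'[THEN conjunct2, THEN conjunct1, rule_format, of p] by (auto intro: span_base)
  have smooth: "smooth_endo A W L" if "L \<in> {J 1, J 2, J 3}" for L
    using Jmem[OF that] J'[THEN conjunct1] by blast
  have alg: "(\<forall>\<alpha>\<in>{1, 2, 3}. J \<alpha> p (J \<alpha> p x) = - x) \<and> J 1 p (J 2 p x) = J 3 p x \<and> J 2 p (J 1 p x) = - J 3 p x"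
    if "p \<in> W" "x \<in> tangent_space A p" for p x
    using J'[THEN conjunct2, THEN conjunct2] that by blast
  have sq: "L p (L p x) = - x" if "L \<in> {J 1, J 2, J 3}" "p \<in> W" "x \<in> tangent_space A p" for L p x
    using Jmem[OF that(1)] alg[OF that(2,3)] by blast
  show ?thesis
  proof
    show "smooth_manifold A" "riemannian_metric A g" "open W" "levi_civita A g Dg" "{J 1, J 2, J 3} = {J 1, J 2, J 3}"
      using M' W Dg by simp_all
    show "is_connection A D" "metric_connection A g D" "is_connection A Dg"
      using D' Dg unfolding levi_civita_def by simp_all
    show "torsion3 A g D Y X Z p = - torsion3 A g D X Y Z p \<and> torsion3 A g D X Z Y p = - torsion3 A g D X Y Z p"
      if "smooth_vfield A W X" "smooth_vfield A W Y" "smooth_vfield A W Z" "p \<in> W" for X Y Z p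
      using D'[THEN conjunct2, THEN conjunct2, THEN conjunct2, rule_format, of W X Y Z] that W by blast
    show "smooth_vfield A W (E b)" if "b \<in> Basis" for b
      using E(1)[OF that] .
    show "g p (E b p) (E c p) = (if b = c then 1 else 0)" if "p \<in> W" "b \<in> Basis" "c \<in> Basis" for p b c
      using E(2)[OF that] .
    show "smooth_endo A W L" if "L \<in> {J 1, J 2, J 3}" for L
      using smooth[OF that] .
    show "L p (L p x) = - x" if "L \<in> {J 1, J 2, J 3}" "p \<in> W" "x \<in> tangent_space A p" for L p x
      using sq[OF that] .
    show "J 1 p (J 2 p x) = J 3 p x" "J 2 p (J 1 p x) = - J 3 p x" if "p \<in> W" "x \<in> tangent_space A p" for p x
      using alg[OF that] by blast+
    show "g p (L p x) (L p y) = g p x y"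
      if "L \<in> {J 1, J 2, J 3}" "p \<in> W" "x \<in> tangent_space A p" "y \<in> tangent_space A p" for L p x y
      using M'[THEN conjunct2, THEN conjunct2, THEN conjunct2, THEN conjunct1, unfolded Q_hermitian_def,
          THEN spec[of _ p], THEN bspec[OF _ LQ[OF that(1,2)]]] sq[OF that(1,2)] that(3,4) by blast
    show "\<exists>a b c. \<forall>Y. smooth_vfield A W Y \<longrightarrow>
        D X (app L Y) p - L p (D X Y p) = a *\<^sub>R J 1 p (Y p) + b *\<^sub>R J 2 p (Y p) + c *\<^sub>R J 3 p (Y p)"
      if L: "L \<in> {J 1, J 2, J 3}" and X: "smooth_vfield A W X" and p: "p \<in> W" for L X p
    proof -
      have "\<exists>K\<in>Q p. \<forall>Y. smooth_vfield A W Y \<longrightarrow> D X (app L Y) p - L p (D X Y p) = K (Y p)"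
        using D'[THEN conjunct2, THEN conjunct2, THEN conjunct1, unfolded preserves_Q_def, rule_format, of W L X p]
          W smooth[OF L] LQ[OF L] X p by blast
      then obtain K where K: "K \<in> span {J 1 p, J 2 p, J 3 p}"
        "\<And>Y. smooth_vfield A W Y \<Longrightarrow> D X (app L Y) p - L p (D X Y p) = K (Y p)"
        using J'[THEN conjunct2, THEN conjunct1, rule_format, OF p] by blast
      obtain a b c where "K - a *\<^sub>R J 1 p - b *\<^sub>R J 2 p - c *\<^sub>R J 3 p = 0"
        using K(1) by (auto simp: span_breakdown_eq)
      then have "K = a *\<^sub>R J 1 p + b *\<^sub>R J 2 p + c *\<^sub>R J 3 p"
        by (simp add: algebra_simps)
      then have "K x = a *\<^sub>R J 1 p x + b *\<^sub>R J 2 p x + c *\<^sub>R J 3 p x" for x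
        by (simp add: scaleR_fun_def[of _ "J _ p"])
      then show ?thesis
        using K(2) by (intro exI[of _ a] exI[of _ b] exI[of _ c]) simp
    qed
    show "torsion3 A g D X Y Z p = torsion3 A g D (app L X) (app L Y) Z p
        + torsion3 A g D (app L X) Y (app L Z) p + torsion3 A g D X (app L Y) (app L Z) p"
      if L: "L \<in> {J 1, J 2, J 3}" and XYZ: "smooth_vfield A W X" "smooth_vfield A W Y" "smooth_vfield A W Z" and p: "p \<in> W" for L X Y Z p
    proof -
      obtain \<alpha> where \<alpha>: "\<alpha> \<in> {1, 2, 3}" "L = J \<alpha>"
        using Jmem[OF L] by blast
      show ?thesis
        unfolding \<alpha>(2)
        using D'[THEN conjunct2, THEN conjunct2, THEN conjunct2, THEN spec[of _ W], THEN spec[of _ X],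
            THEN spec[of _ Y], THEN spec[of _ Z], THEN mp, OF conjI[OF W conjI[OF XYZ(1) conjI[OF XYZ(2,3)]]],
            THEN conjunct2, THEN spec[of _ J], THEN mp[OF _ J], THEN bspec[OF _ \<alpha>(1)], THEN bspec[OF _ p]] .
    qed
  qed
qed

theorem proposition3p5:
  fixes A :: "('m::{t2_space, second_countable_topology}, 'e::euclidean_space) chart set"
    and g :: "'m metric" and Q :: "'m endobundle"
    and D Dg :: "'m connection"
    and n :: nat
  assumes "DIM('e) = 4 * n" and "n > 1"
    and "QKT_manifold A g Q"
    and "QKT_connection A g Q D"
    and "levi_civita A g Dg"
  shows "\<forall>W e J. open W \<and> orthonormal_frame A g W (4 * n) e \<and> admissible_basis A Q W J \<longrightarrow>
    (\<forall>\<alpha>\<in>{1, 2, 3}. \<forall>\<beta>\<in>{1, 2, 3}. \<forall>\<gamma>\<in>{1, 2, 3}. \<forall>p\<in>W.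
      (let N = 4 * n;
           t = torsion1 A g D N e (J \<alpha>);
           ScalQ = scalQ A g D N e (J \<beta>) p;
           ScalgQ = scalQ A g Dg N e (J \<gamma>) p;
           Scal = scal A g D N e p;
           Scalg = scal A g Dg N e p;
           \<delta>t = codiff Dg N e t p;
           nt = norm2_1form N e t p;
           nT = norm2_torsion A g D N e p
       in Scalg = (real n + 2) / real n * ScalQ - 3 * \<delta>t + 2 * nt - 1/12 * nT \<and>
          ScalgQ = ScalQ - \<delta>t + nt - 1/12 * nT \<and>
          Scal = (real n + 2) / real n * ScalQ - 3 * \<delta>t + 2 * nt - 1/3 * nT))"
proof (intro allI impI ballI)
  fix W e J \<alpha> \<beta> \<gamma> p
  assume H: "open W \<and> orthonormal_frame A g W (4 * n) e \<and> admissible_basis A Q W J"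
    and \<alpha>: "\<alpha> \<in> {1, 2, 3::nat}" and \<beta>: "\<beta> \<in> {1, 2, 3::nat}" and \<gamma>: "\<gamma> \<in> {1, 2, 3::nat}" and p: "p \<in> W"
  \<comment> \<open>The given frame is numbered, while the model tensors are indexed by the standard
    basis. Any bijection serves, since the quantities involved are sums over the frame.\<close>
  obtain h :: "'e \<Rightarrow> nat" where h: "bij_betw h Basis {1..4 * n}"
    using finite_same_card_bij[of "Basis :: 'e set" "{1..4 * n}"] assms(1) by auto
  define E where "E b = e (h b)" for b
  have sum_E: "(\<Sum>i=1..4 * n. F (e i)) = (\<Sum>b\<in>Basis. F (E b))" for F :: "'m vfield \<Rightarrow> real"
    unfolding E_def by (rule sum.reindex_bij_betw[OF h, symmetric])
  have h_mem: "h b \<in> {1..4 * n}" and h_inj: "c \<in> Basis \<Longrightarrow> h b = h c \<longleftrightarrow> b = c" if "b \<in> Basis" for b c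
    using h that by (auto simp: bij_betw_def inj_on_def)
  have frame: "\<forall>i\<in>{1..4 * n}. smooth_vfield A W (e i)"
    "\<forall>p\<in>W. \<forall>i\<in>{1..4 * n}. \<forall>j\<in>{1..4 * n}. g p (e i p) (e j p) = (if i = j then 1 else 0)"
    using H unfolding orthonormal_frame_def by blast+
  interpret q: quaternionic_torsion A W D Dg g E "J 1" "J 2" "J 3" "{J 1, J 2, J 3}"
  proof (rule QKT_quaternionic_torsion[OF assms(3-5)])
    show "open W" "admissible_basis A Q W J"
      using H by simp_all
    show "smooth_vfield A W (E b)" if "b \<in> Basis" for b
      using frame(1) h_mem[OF that] by (simp add: E_def)
    show "g p (E b p) (E c p) = (if b = c then 1 else 0)" if "p \<in> W" "b \<in> Basis" "c \<in> Basis" for p b c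
      using frame(2) h_mem[OF that(2)] h_mem[OF that(3)] h_inj[OF that(2,3)] that(1) by (simp add: E_def)
  qed
  have mem: "J \<alpha> \<in> {J 1, J 2, J 3}" "J \<beta> \<in> {J 1, J 2, J 3}" "J \<gamma> \<in> {J 1, J 2, J 3}"
    using \<alpha> \<beta> \<gamma> by blast+
  have tau: "torsion1 A g D (4 * n) e (J \<alpha>) X = q.tau (J \<alpha>) X" for X
    unfolding torsion1_def q.tau_def by (simp only: sum_E[of "\<lambda>V. torsion3 A g D (app (J \<alpha>) X) V (app (J \<alpha>) V) _"])
  have div: "codiff Dg (4 * n) e (torsion1 A g D (4 * n) e (J \<alpha>)) p = - q.divergence (J \<alpha>) p"
    unfolding codiff_def q.divergence_def tau
    by (simp only: sum_E[of "\<lambda>V. V p (q.tau (J \<alpha>) V) - q.tau (J \<alpha>) (Dg V V) p"])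
  have nt: "norm2_1form (4 * n) e (torsion1 A g D (4 * n) e (J \<alpha>)) p = (\<Sum>a\<in>Basis. (q.tau (J \<alpha>) (E a) p)\<^sup>2)"
    unfolding norm2_1form_def tau by (simp only: sum_E[of "\<lambda>V. (q.tau (J \<alpha>) V p)\<^sup>2"])
  have nT: "norm2_torsion A g D (4 * n) e p
      = (\<Sum>a\<in>Basis. \<Sum>b\<in>Basis. \<Sum>c\<in>Basis. (torsion3 A g D (E a) (E b) (E c) p)\<^sup>2)"
    unfolding norm2_torsion_def
    by (simp only: sum_E[of "\<lambda>V. (torsion3 A g D _ _ V p)\<^sup>2"]
        sum_E[of "\<lambda>V. \<Sum>c\<in>Basis. (torsion3 A g D _ V (E c) p)\<^sup>2"]
        sum_E[of "\<lambda>V. \<Sum>b\<in>Basis. \<Sum>c\<in>Basis. (torsion3 A g D V (E b) (E c) p)\<^sup>2"])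
  have scal: "scal A g C (4 * n) e p = (\<Sum>a\<in>Basis. \<Sum>b\<in>Basis. curv4 A g C (E b) (E a) (E a) (E b) p)" for C
    unfolding scal_def ricci_def
    by (simp only: sum_E[of "\<lambda>V. curv4 A g C V _ _ V p"]
        sum_E[of "\<lambda>V. \<Sum>b\<in>Basis. curv4 A g C (E b) V V (E b) p"])
  have scalQ: "scalQ A g C (4 * n) e K p
      = - (\<Sum>a\<in>Basis. 1/2 * (\<Sum>b\<in>Basis. curv4 A g C (E a) (app K (E a)) (E b) (app K (E b)) p))" for C K
    unfolding scalQ_def ricci_form_def
    by (simp only: sum_E[of "\<lambda>V. curv4 A g C _ _ V (app K V) p"]
        sum_E[of "\<lambda>V. 1/2 * (\<Sum>b\<in>Basis. curv4 A g C V (app K V) (E b) (app K (E b)) p)"])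
  show "let N = 4 * n;
           t = torsion1 A g D N e (J \<alpha>);
           ScalQ = scalQ A g D N e (J \<beta>) p;
           ScalgQ = scalQ A g Dg N e (J \<gamma>) p;
           Scal = scal A g D N e p;
           Scalg = scal A g Dg N e p;
           \<delta>t = codiff Dg N e t p;
           nt = norm2_1form N e t p;
           nT = norm2_torsion A g D N e p
       in Scalg = (real n + 2) / real n * ScalQ - 3 * \<delta>t + 2 * nt - 1/12 * nT \<and>
          ScalgQ = ScalQ - \<delta>t + nt - 1/12 * nT \<and>
          Scal = (real n + 2) / real n * ScalQ - 3 * \<delta>t + 2 * nt - 1/3 * nT"
    unfolding Let_def div nt nT scal scalQ
    using q.scalar_relations[OF assms(1,2) mem p] by simp
qed

end
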